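(* Let $G$ be a finite simple graph and let $\lambda_v,\mu_v$, $v\in V(G)$, be nonnegative reals. Write $d_v\coloneqq\deg_G(v)$. Then \[ Z^{(2)}_G(\bm{\lambda},\bm{\mu})\ \ge\ \prod_{v\in V(G)} Z^{(2)}_{K_{d_v+1}}(\lambda_v,\mu_v)^{\frac{1}{d_v+1}}=\prod_{v\in V(G)}\bigl((d_v+1)d_v\lambda_v\mu_v+(d_v+1)(\lambda_v+\mu_v)+1\bigr)^{\frac{1}{d_v+1}}. \]
   Context: $\mathcal{I}(G)$ is the set of independent sets of $G$ (including the empty set). For $\bm{\lambda}=(\lambda_v),\bm{\mu}=(\mu_v)\in\mathbb{R}^{V(G)}$, $Z^{(2)}_G(\bm{\lambda},\bm{\mu})\coloneqq\sum_{I,J\in\mathcal{I}(G),\ I\cap J=\emptyset}\prod_{v\in I}\lambda_v\prod_{u\in J}\mu_u$, and for scalars $\lambda,\mu$, $Z^{(2)}_G(\lambda,\mu)$ denotes $Z^{(2)}_G(\lambda\mathbf{1},\mu\mathbf{1})$. $K_m$ is the complete graph on $m$ vertices. *)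

theory Defs
  imports Complex_Main
begin

text \<open>A simple graph is given by its vertex set and a set of edges, each edge being
  a two-element set of vertices.\<close>

definition finite_simple_graph :: "'a set \<Rightarrow> 'a set set \<Rightarrow> bool" where
  "finite_simple_graph V E \<longleftrightarrow> finite V \<and> (\<forall>e\<in>E. e \<subseteq> V \<and> card e = 2)"

definition graph_degree :: "'a set set \<Rightarrow> 'a \<Rightarrow> nat" where
  "graph_degree E v = card {e \<in> E. v \<in> e}"

definition independent_sets :: "'a set \<Rightarrow> 'a set set \<Rightarrow> 'a set set" where
  "independent_sets V E = {I. I \<subseteq> V \<and> (\<forall>u\<in>I. \<forall>v\<in>I. {u, v} \<notin> E)}"

definition Z2 :: "'a set \<Rightarrow> 'a set set \<Rightarrow> ('a \<Rightarrow> real) \<Rightarrow> ('a \<Rightarrow> real) \<Rightarrow> real" where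
  "Z2 V E lam mu =
     (\<Sum>(I, J) \<in> {(I, J). I \<in> independent_sets V E \<and> J \<in> independent_sets V E \<and> I \<inter> J = {}}.
        (\<Prod>v\<in>I. lam v) * (\<Prod>u\<in>J. mu u))"

definition complete_edges :: "'a set \<Rightarrow> 'a set set" where
  "complete_edges V = {e. e \<subseteq> V \<and> card e = 2}"

definition Z2_complete :: "nat \<Rightarrow> real \<Rightarrow> real \<Rightarrow> real" where
  "Z2_complete m l k = Z2 {..<m} (complete_edges {..<m}) (\<lambda>_. l) (\<lambda>_. k)"

end

theory Submission
  imports Defs "HOL-Analysis.Analysis"
begin

text \<open>Induction on the number of vertices. For a vertex $v$ of maximum degree $d$ with neighbourhood $N$,
  conditioning on the state of $v$ gives
  \[ Z_G(\lambda,\mu) = Z_{G-v}(\lambda,\mu) + \lambda_v Z_{G-v}(\lambda 1_{V - N},\mu)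
     + \mu_v Z_{G-v}(\lambda,\mu 1_{V - N}), \]
  and the induction hypothesis applies to the three terms. With $f_m(l,k)$ the root attached to a vertex of
  degree $m$, it remains to show
  \[ \prod_{u \in N} f_{m_u-1}(l_u,k_u) + a \prod_{u \in N} f_{m_u-1}(0,k_u) + b \prod_{u \in N} f_{m_u-1}(l_u,0)
     \ge f_d(a,b) \prod_{u \in N} f_{m_u}(l_u,k_u) \]
  whenever $1 \le m_u \le d = |N|$. Weighted AM-GM decouples the neighbours, and what is left is to
  minimize a function of a single triple $(m_u,l_u,k_u)$. Letting $m_u$ be real, its only
  minimizer turns out to be $(d,a,b)$, the configuration of the complete graph.\<close>

section \<open>The partition function under deletion of a vertex\<close>

text \<open>The maximality of d enters through m_u <= d: at critical points, increasing m lowers the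
  one-neighbour function, so the right end of the range of m has to be d. The obstacle is that the
  sign of the m-derivative is controlled only where both (s,t)-derivatives vanish; there 1 - w_1 -
  w_2 becomes (m - IJ)/(m + H), and the weights drop out. Hence a global minimizer on a compact box
  is studied instead of monotonicity in m. The coordinates are chosen so that f_{m-1}(l,0) = exp(s)
  and f_{m-1}(0,k) = exp(t): holding s and t fixed while m varies keeps two of the three AM-GM terms
  linear, and stationarity is rational in I = 1 - exp(-ms) and J = 1 - exp(-mt).\<close>

lemma finite_independent_sets: "finite V \<Longrightarrow> finite (independent_sets V E)"
  by (rule finite_subset[of _ "Pow V"]) (auto simp: independent_sets_def)

lemma finite_independent_pairs:
  "finite V \<Longrightarrow> finite {(I, J). I \<in> independent_sets V E \<and> J \<in> independent_sets V E \<and> I \<inter> J = {} \<and> P I J}"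
  by (rule finite_subset[of _ "independent_sets V E \<times> independent_sets V E"])
    (auto simp: finite_independent_sets)

lemma Z2_commute: "Z2 V E lam mu = Z2 V E mu lam"
  unfolding Z2_def
  by (rule sum.reindex_bij_witness[of _ prod.swap prod.swap]) auto

lemma Z2_cong:
  assumes "\<And>v. v \<in> V \<Longrightarrow> lam v = lam' v" "\<And>v. v \<in> V \<Longrightarrow> mu v = mu' v"
  shows "Z2 V E lam mu = Z2 V E lam' mu'"
proof -
  have "prod lam I = prod lam' I" "prod mu I = prod mu' I" if "I \<in> independent_sets V E" for I
    using that assms by (auto simp: independent_sets_def intro!: prod.cong)
  then show ?thesis unfolding Z2_def by (intro sum.cong) auto
qed

lemma Z2_empty: "Z2 {} E lam mu = 1"
proof -
  have "{(I, J). I \<in> independent_sets {} E \<and> J \<in> independent_sets {} E \<and> I \<inter> J = {}} = {({}, {})}"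
    by (auto simp: independent_sets_def)
  then show ?thesis by (simp add: Z2_def)
qed

lemma independent_sets_delete_vertex:
  "independent_sets (V - {v}) {e \<in> E. v \<notin> e} = {I \<in> independent_sets V E. v \<notin> I}"
  by (auto simp: independent_sets_def)

lemma insert_mem_independent_sets:
  assumes "finite_simple_graph V E" "v \<in> V" "v \<notin> I"
  shows "insert v I \<in> independent_sets V E \<longleftrightarrow> I \<in> independent_sets V E \<and> I \<inter> {u. {u, v} \<in> E} = {}"
proof -
  \<comment> \<open>\<open>independent_sets\<close> also tests u = v, where {u, v} is a singleton;
    edges have two elements, so no vertex is excluded by this.\<close>
  have "{v} \<notin> E" using assms(1) by (auto simp: finite_simple_graph_def)
  then show ?thesis using assms(2) by (auto simp: independent_sets_def insert_commute)
qed

text \<open>Neighbours of v stay in the graph with weight 0, so a set I meeting the neighbourhood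
  contributes nothing. Only the weights for I change: J may still contain neighbours of v, since I
  and J are merely disjoint.\<close>

lemma sum_pairs_containing_vertex:
  assumes G: "finite_simple_graph V E" and v: "v \<in> V"
  shows "(\<Sum>(I, J) \<in> {(I, J). I \<in> independent_sets V E \<and> J \<in> independent_sets V E \<and> I \<inter> J = {} \<and> v \<in> I}.
      prod lam I * prod mu J)
    = lam v * Z2 (V - {v}) {e \<in> E. v \<notin> e} (\<lambda>u. if {u, v} \<in> E then 0 else lam u) mu"
proof -
  let ?N = "{u. {u, v} \<in> E}" and ?S = "independent_sets V E"
  let ?lam = "\<lambda>u. if {u, v} \<in> E then 0 else lam u"
  let ?B = "{(I, J). I \<in> ?S \<and> J \<in> ?S \<and> I \<inter> J = {} \<and> v \<notin> I \<and> v \<notin> J}"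
  let ?B1 = "{(I, J). I \<in> ?S \<and> J \<in> ?S \<and> I \<inter> J = {} \<and> v \<notin> I \<and> v \<notin> J \<and> I \<inter> ?N = {}}"
  have V: "finite V" using G by (simp add: finite_simple_graph_def)
  have fin: "finite I" if "I \<in> ?S" for I
    using that V by (auto simp: independent_sets_def intro: finite_subset)
  note ins = insert_mem_independent_sets[OF G v]
  have "(\<Sum>(I, J) \<in> {(I, J). I \<in> ?S \<and> J \<in> ?S \<and> I \<inter> J = {} \<and> v \<in> I}. prod lam I * prod mu J)
      = (\<Sum>(I, J) \<in> ?B1. lam v * (prod lam I * prod mu J))"
  proof (rule sum.reindex_bij_witness[of _ "\<lambda>(I, J). (insert v I, J)" "\<lambda>(I, J). (I - {v}, J)"])
    fix p assume p: "p \<in> {(I, J). I \<in> ?S \<and> J \<in> ?S \<and> I \<inter> J = {} \<and> v \<in> I}"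
    then obtain I J where IJ: "p = (I, J)" "I \<in> ?S" "J \<in> ?S" "I \<inter> J = {}" "v \<in> I" by auto
    have I: "insert v (I - {v}) = I" using IJ by auto
    then show "(\<lambda>(I, J). (insert v I, J)) ((\<lambda>(I, J). (I - {v}, J)) p) = p" using IJ by simp
    have "I - {v} \<in> ?S \<and> (I - {v}) \<inter> ?N = {}" using ins[of "I - {v}"] I IJ by simp
    then show "(\<lambda>(I, J). (I - {v}, J)) p \<in> ?B1" using IJ by auto
    have "prod lam I = lam v * prod lam (I - {v})" using fin IJ by (intro prod.remove) auto
    then show "(case (\<lambda>(I, J). (I - {v}, J)) p of (I, J) \<Rightarrow> lam v * (prod lam I * prod mu J))
        = (case p of (I, J) \<Rightarrow> prod lam I * prod mu J)" using IJ by simp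
  next
    fix p assume p: "p \<in> ?B1"
    then obtain I J where IJ: "p = (I, J)" "I \<in> ?S" "J \<in> ?S" "I \<inter> J = {}" "v \<notin> I" "v \<notin> J" "I \<inter> ?N = {}"
      by auto
    then show "(\<lambda>(I, J). (I - {v}, J)) ((\<lambda>(I, J). (insert v I, J)) p) = p" by simp
    show "(\<lambda>(I, J). (insert v I, J)) p \<in> {(I, J). I \<in> ?S \<and> J \<in> ?S \<and> I \<inter> J = {} \<and> v \<in> I}"
      using ins[of I] IJ by simp
  qed
  also have "\<dots> = (\<Sum>(I, J) \<in> ?B. lam v * (prod ?lam I * prod mu J))"
  proof (rule sum.mono_neutral_cong_left)
    show "finite ?B" using finite_independent_pairs[OF V] by simp
    show "?B1 \<subseteq> ?B" by auto
    show "\<forall>p\<in>?B - ?B1. (case p of (I, J) \<Rightarrow> lam v * (prod ?lam I * prod mu J)) = 0"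
    proof
      fix p assume "p \<in> ?B - ?B1"
      then obtain I J u where p: "p = (I, J)" "I \<in> ?S" "u \<in> I" "{u, v} \<in> E" by auto
      then have "prod ?lam I = 0" using fin by (intro prod_zero) auto
      then show "(case p of (I, J) \<Rightarrow> lam v * (prod ?lam I * prod mu J)) = 0" using p by simp
    qed
    fix p assume "p \<in> ?B1"
    then obtain I J where IJ: "p = (I, J)" "I \<inter> ?N = {}" by auto
    then have "prod ?lam I = prod lam I" by (intro prod.cong) auto
    then show "(case p of (I, J) \<Rightarrow> lam v * (prod lam I * prod mu J))
        = (case p of (I, J) \<Rightarrow> lam v * (prod ?lam I * prod mu J))" using IJ by simp
  qed
  also have "\<dots> = lam v * Z2 (V - {v}) {e \<in> E. v \<notin> e} ?lam mu"
    unfolding Z2_def independent_sets_delete_vertex sum_distrib_left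
    by (intro sum.cong) auto
  finally show ?thesis .
qed

lemma Z2_vertex_recurrence:
  assumes G: "finite_simple_graph V E" and v: "v \<in> V"
  shows "Z2 V E lam mu = Z2 (V - {v}) {e \<in> E. v \<notin> e} lam mu
    + lam v * Z2 (V - {v}) {e \<in> E. v \<notin> e} (\<lambda>u. if {u, v} \<in> E then 0 else lam u) mu
    + mu v * Z2 (V - {v}) {e \<in> E. v \<notin> e} lam (\<lambda>u. if {u, v} \<in> E then 0 else mu u)"
proof -
  let ?S = "independent_sets V E"
  let ?f = "\<lambda>(I, J). prod lam I * prod mu J"
  let ?A0 = "{(I, J). I \<in> ?S \<and> J \<in> ?S \<and> I \<inter> J = {} \<and> v \<notin> I \<and> v \<notin> J}"
  let ?A1 = "{(I, J). I \<in> ?S \<and> J \<in> ?S \<and> I \<inter> J = {} \<and> v \<in> I}"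
  let ?A2 = "{(I, J). I \<in> ?S \<and> J \<in> ?S \<and> I \<inter> J = {} \<and> v \<in> J}"
  have V: "finite V" using G by (simp add: finite_simple_graph_def)
  have fin: "finite ?A0" "finite ?A1" "finite ?A2" using finite_independent_pairs[OF V] by simp_all
  have "Z2 V E lam mu = sum ?f (?A0 \<union> ?A1 \<union> ?A2)"
    unfolding Z2_def by (intro sum.cong) auto
  also have "\<dots> = sum ?f ?A0 + sum ?f ?A1 + sum ?f ?A2"
    using fin by (subst sum.union_disjoint; (subst sum.union_disjoint)?) auto
  also have "sum ?f ?A0 = Z2 (V - {v}) {e \<in> E. v \<notin> e} lam mu"
    unfolding Z2_def independent_sets_delete_vertex by (intro sum.cong) auto
  also have "sum ?f ?A1 = lam v * Z2 (V - {v}) {e \<in> E. v \<notin> e} (\<lambda>u. if {u, v} \<in> E then 0 else lam u) mu"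
    by (rule sum_pairs_containing_vertex[OF G v])
  also have "sum ?f ?A2 = (\<Sum>(I, J) \<in> ?A1. prod mu I * prod lam J)"
    by (rule sum.reindex_bij_witness[of _ prod.swap prod.swap]) auto
  also have "\<dots> = mu v * Z2 (V - {v}) {e \<in> E. v \<notin> e} lam (\<lambda>u. if {u, v} \<in> E then 0 else mu u)"
    unfolding sum_pairs_containing_vertex[OF G v] by (subst Z2_commute) (rule refl)
  finally show ?thesis .
qed

section \<open>Degrees after deleting a vertex, and the value on complete graphs\<close>

lemma finite_simple_graph_delete_vertex:
  "finite_simple_graph V E \<Longrightarrow> finite_simple_graph (V - {v}) {e \<in> E. v \<notin> e}"
  by (auto simp: finite_simple_graph_def)

lemma finite_edges: "finite_simple_graph V E \<Longrightarrow> finite E"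
  by (rule finite_subset[of _ "Pow V"]) (auto simp: finite_simple_graph_def)

lemma edge_through_two_vertices:
  assumes "finite_simple_graph V E" "e \<in> E" "u \<in> e" "v \<in> e" "u \<noteq> v"
  shows "e = {u, v}"
proof -
  have "card e = 2" "finite e"
    using assms by (auto simp: finite_simple_graph_def intro: finite_subset)
  then show ?thesis using assms card_subset_eq[of e "{u, v}"] by auto
qed

lemma graph_degree_delete_vertex:
  assumes G: "finite_simple_graph V E" and uv: "u \<noteq> v"
  shows "graph_degree {e \<in> E. v \<notin> e} u = (if {u, v} \<in> E then graph_degree E u - 1 else graph_degree E u)"
proof (cases "{u, v} \<in> E")
  case True
  have "{e \<in> {e \<in> E. v \<notin> e}. u \<in> e} = {e \<in> E. u \<in> e} - {{u, v}}"
    using edge_through_two_vertices[OF G] uv by auto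
  then show ?thesis using True finite_edges[OF G] by (simp add: graph_degree_def)
next
  case False
  have "{e \<in> {e \<in> E. v \<notin> e}. u \<in> e} = {e \<in> E. u \<in> e}"
    using edge_through_two_vertices[OF G] uv False by auto
  then show ?thesis using False by (simp add: graph_degree_def)
qed

lemma graph_degree_eq_card_neighbours:
  assumes G: "finite_simple_graph V E"
  shows "graph_degree E v = card {u. {u, v} \<in> E}"
proof -
  have two: "card e = 2" if "e \<in> E" for e using G that by (auto simp: finite_simple_graph_def)
  have "{e \<in> E. v \<in> e} = (\<lambda>u. {u, v}) ` {u. {u, v} \<in> E}"
  proof (intro equalityI subsetI)
    fix e assume e: "e \<in> {e \<in> E. v \<in> e}"
    then obtain x y where "e = {x, y}" "x \<noteq> y" using two card_2_iff by (metis mem_Collect_eq)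
    with e show "e \<in> (\<lambda>u. {u, v}) ` {u. {u, v} \<in> E}" by (auto simp: insert_commute)
  qed auto
  moreover have "inj_on (\<lambda>u. {u, v}) {u. {u, v} \<in> E}"
    by (rule inj_onI) (auto simp: doubleton_eq_iff)
  ultimately show ?thesis by (simp add: graph_degree_def card_image)
qed

text \<open>Every other vertex is a neighbour, so the recurrence evaluates the smaller complete
  graph at (l,k), (0,k) and (l,0); hence l and k are generalized in the induction.\<close>

lemma Z2_complete_edges:
  assumes "finite V"
  shows "Z2 V (complete_edges V) (\<lambda>_. l) (\<lambda>_. k)
    = real (card V) * (real (card V) - 1) * l * k + real (card V) * (l + k) + 1"
  using assms
proof (induction V arbitrary: l k rule: finite_induct)
  case empty
  then show ?case by (simp add: Z2_empty)
next
  case (insert v F)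
  have G: "finite_simple_graph (insert v F) (complete_edges (insert v F))"
    using insert by (auto simp: finite_simple_graph_def complete_edges_def)
  have del: "insert v F - {v} = F" "{e \<in> complete_edges (insert v F). v \<notin> e} = complete_edges F"
    using insert by (auto simp: complete_edges_def)
  have nb: "{u, v} \<in> complete_edges (insert v F)" if "u \<in> F" for u
    using that insert by (auto simp: complete_edges_def card_insert_if)
  have "Z2 (insert v F) (complete_edges (insert v F)) (\<lambda>_. l) (\<lambda>_. k)
      = Z2 F (complete_edges F) (\<lambda>_. l) (\<lambda>_. k) + l * Z2 F (complete_edges F) (\<lambda>_. 0) (\<lambda>_. k)
        + k * Z2 F (complete_edges F) (\<lambda>_. l) (\<lambda>_. 0)"
    unfolding Z2_vertex_recurrence[OF G insertI1] del
    using nb by (intro arg_cong2[of _ _ _ _ "(+)"] arg_cong2[of _ _ _ _ "(*)"] Z2_cong refl) auto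
  then show ?case unfolding insert.IH using insert.hyps by (simp add: algebra_simps)
qed

lemma Z2_complete_eq:
  "Z2_complete (d + 1) l k = (real d + 1) * real d * l * k + (real d + 1) * (l + k) + 1"
  unfolding Z2_complete_def using Z2_complete_edges[of "{..<d + 1}" l k] by (simp add: algebra_simps)

section \<open>Dependence on the degree\<close>

lemma nonneg_if_deriv_nonneg:
  fixes f f' :: "real \<Rightarrow> real"
  assumes "0 \<le> x" and "f 0 = 0"
    and "\<And>y. 0 \<le> y \<Longrightarrow> y \<le> x \<Longrightarrow> (f has_real_derivative f' y) (at y)"
    and "\<And>y. 0 \<le> y \<Longrightarrow> y \<le> x \<Longrightarrow> 0 \<le> f' y"
  shows "0 \<le> f x"
proof -
  have "f 0 \<le> f x"
    by (rule DERIV_nonneg_imp_nondecreasing[OF \<open>0 \<le> x\<close>]) (use assms in blast)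
  then show ?thesis using assms by simp
qed

lemma ln_one_plus_le_cubic:
  fixes x :: real
  assumes "0 \<le> x"
  shows "ln (1 + x) \<le> x - x^2/2 + x^3/3"
proof -
  have "0 \<le> x - x^2/2 + x^3/3 - ln (1 + x)"
  proof (rule nonneg_if_deriv_nonneg[OF assms, where f = "\<lambda>x. x - x^2/2 + x^3/3 - ln (1 + x)"
        and f' = "\<lambda>y. y^3 / (1 + y)"])
    fix y :: real assume "0 \<le> y" "y \<le> x"
    then show "((\<lambda>x. x - x^2/2 + x^3/3 - ln (1 + x)) has_real_derivative y^3 / (1 + y)) (at y)"
      by (auto intro!: derivative_eq_intros simp: field_simps power2_eq_square power3_eq_cube)
  qed auto
  then show ?thesis by simp
qed

text \<open>Integrates the cubic bound, because (1 + x) ln (1 + x) has derivative 1 + ln (1 + x). At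
  x = 1 - q^2 it replaces the second logarithm of \<open>diagonal_ineq\<close> by a
  polynomial.\<close>

lemma one_plus_ln_one_plus_le_quartic:
  fixes x :: real
  assumes "0 \<le> x"
  shows "(1 + x) * ln (1 + x) \<le> x + x^2/2 - x^3/6 + x^4/12"
proof -
  have "0 \<le> x + x^2/2 - x^3/6 + x^4/12 - (1 + x) * ln (1 + x)"
  proof (rule nonneg_if_deriv_nonneg[OF assms,
        where f = "\<lambda>x. x + x^2/2 - x^3/6 + x^4/12 - (1 + x) * ln (1 + x)"
          and f' = "\<lambda>y. y - y^2/2 + y^3/3 - ln (1 + y)"])
    fix y :: real assume y: "0 \<le> y" "y \<le> x"
    then show "((\<lambda>x. x + x^2/2 - x^3/6 + x^4/12 - (1 + x) * ln (1 + x)) has_real_derivative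
        y - y^2/2 + y^3/3 - ln (1 + y)) (at y)"
      by (auto intro!: derivative_eq_intros simp: power2_eq_square power3_eq_cube add_nonneg_eq_0_iff)
    show "0 \<le> y - y^2/2 + y^3/3 - ln (1 + y)"
      using ln_one_plus_le_cubic[OF y(1)] by simp
  qed auto
  then show ?thesis by simp
qed

text \<open>The numerator of the derivative in the next lemma. It is $(1-q)^2$ times a polynomial whose
  minimum on $[0,1]$ is small and attained near $1/2$, hence the expansion about $1/2$.\<close>
lemma diagonal_polynomial_nonneg:
  fixes q :: real
  assumes "0 \<le> q" "q \<le> 1"
  shows "0 \<le> 16 - 274/3*q + 559/3*q^2 - 476/3*q^3 + 44*q^4 + 12*q^5 - 10*q^6 - 20/3*q^7
      + 20/3*q^8 + 14/3*q^9 - 3*q^10"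
proof -
  define x where "x = 1/2 - q"
  have x: "\<bar>x\<bar> \<le> 1/2" using assms unfolding x_def by linarith
  have pw: "\<bar>x^k\<bar> \<le> (1/2)^k" for k
    using power_mono[OF x, of k] by (simp add: power_abs)
  have bounds: "\<bar>x\<bar> \<le> 1/2" "x^2 \<le> 1/4" "\<bar>x^3\<bar> \<le> 1/8" "x^4 \<le> 1/16" "\<bar>x^5\<bar> \<le> 1/32" "x^6 \<le> 1/64"
    using pw[of 1] pw[of 2] pw[of 3] pw[of 4] pw[of 5] pw[of 6] by (simp_all add: power_divide)
  have "0 \<le> x^2" "0 \<le> x^4" "0 \<le> x^6" by simp_all
  \<comment> \<open>The coefficient 587/8 of x^2 is split: 50 goes into the quadratic completed to a
    square below, and the remaining 187/8 outweighs all higher terms for |x| <= 1/2.\<close>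
  with bounds have "0 \<le> 587/8 - 50 + (- 107/3*x + 703/24*x^2 - 5/3*x^3 - 56/3*x^4 + 40/3*x^5 - 3*x^6)"
    by linarith
  then have "0 \<le> x^2 * (587/8 - 50 + (- 107/3*x + 703/24*x^2 - 5/3*x^3 - 56/3*x^4 + 40/3*x^5 - 3*x^6))"
    by (intro mult_nonneg_nonneg) auto
  moreover have "0 \<le> 33/256 + 13/16*x + 50*x^2"
  proof -
    have "33/256 + 13/16*x + 50*x^2 = 50 * (x + 13/1600)^2 + (33/256 - 50 * (13/1600)^2)"
      by (simp add: power2_eq_square algebra_simps)
    then show ?thesis by (simp add: power2_eq_square)
  qed
  ultimately have "0 \<le> (1 - q)^2 * (33/256 + 13/16*x + 50*x^2
      + x^2 * (587/8 - 50 + (- 107/3*x + 703/24*x^2 - 5/3*x^3 - 56/3*x^4 + 40/3*x^5 - 3*x^6)))"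
    by (intro mult_nonneg_nonneg) auto
  also have "\<dots> = 16 - 274/3*q + 559/3*q^2 - 476/3*q^3 + 44*q^4 + 12*q^5 - 10*q^6 - 20/3*q^7
      + 20/3*q^8 + 14/3*q^9 - 3*q^10"
    unfolding x_def by algebra
  finally show ?thesis .
qed

text \<open>Four times the case x = y of \<open>degree_gain_one_ge\<close>, with q = exp (- x). Once
  the second logarithm is bounded by a polynomial, division by \<open>C\<close> isolates ln q, so
  \<open>- ln q - B q / C q\<close> has a rational derivative; this function vanishes at q = 1 and
  is nonincreasing.\<close>

lemma diagonal_ineq:
  fixes q :: real
  assumes "0 < q" "q \<le> 1"
  shows "0 \<le> - ln q * (4 + 8*q - 6*q^2) - 10 + 16*q - 6*q^2 - (2 - q^2) * ln (2 - q^2)"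
proof -
  define B where "B = (\<lambda>q::real. 10 - 16*q + 6*q^2 + ((1-q^2) + (1-q^2)^2/2 - (1-q^2)^3/6 + (1-q^2)^4/12))"
  define C where "C = (\<lambda>q::real. 4 + 8*q - 6*q^2)"
  have Cpos: "0 < C y" if "0 < y" "y \<le> 1" for y
  proof -
    have "y^2 \<le> y" using that by (simp add: power2_eq_square mult_left_le)
    then show ?thesis using that unfolding C_def by linarith
  qed
  have "- ln 1 - B 1 / C 1 \<le> - ln q - B q / C q"
  proof (rule DERIV_nonpos_imp_nonincreasing[OF assms(2), where f = "\<lambda>q. - ln q - B q / C q"])
    fix y assume y: "q \<le> y" "y \<le> 1"
    then have y0: "0 < y" using assms by simp
    define B' where "B' = -16 + 12*y - 2*y*(1 + (1-y^2) - (1-y^2)^2/2 + (1-y^2)^3/3)"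
    define C' where "C' = 8 - 12*y"
    have dB: "(B has_real_derivative B') (at y)"
      unfolding B_def B'_def
      by (auto intro!: derivative_eq_intros simp: field_simps power2_eq_square power3_eq_cube)
    have dC: "(C has_real_derivative C') (at y)"
      unfolding C_def C'_def by (auto intro!: derivative_eq_intros)
    have "((\<lambda>q. - ln q - B q / C q) has_real_derivative - (1/y) - (B' * C y - B y * C') / (C y * C y)) (at y)"
      using y0 Cpos[OF y0 y(2)]
      by (auto intro!: derivative_eq_intros dB dC)
    moreover have "- (1/y) - (B' * C y - B y * C') / (C y * C y) \<le> 0"
    proof -
      have "0 \<le> 16 - 274/3*y + 559/3*y^2 - 476/3*y^3 + 44*y^4 + 12*y^5 - 10*y^6 - 20/3*y^7
          + 20/3*y^8 + 14/3*y^9 - 3*y^10"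
        using diagonal_polynomial_nonneg y y0 by simp
      also have "\<dots> = C y * C y + y * (B' * C y - B y * C')"
        unfolding B_def C_def B'_def C'_def by (simp add: field_simps eval_nat_numeral)
      finally have "0 \<le> (C y * C y + y * (B' * C y - B y * C')) / (y * (C y * C y))"
        using y0 Cpos[OF y0 y(2)] by simp
      also have "\<dots> = 1/y + (B' * C y - B y * C') / (C y * C y)"
        using y0 Cpos[OF y0 y(2)] by (simp add: field_simps)
      finally show ?thesis by simp
    qed
    ultimately show "\<exists>d. ((\<lambda>q. - ln q - B q / C q) has_real_derivative d) (at y) \<and> d \<le> 0" by blast
  qed
  then have "B q / C q \<le> - ln q" by (simp add: B_def)
  then have "B q \<le> - ln q * C q" using Cpos[OF assms] by (simp add: field_simps)
  moreover have "(1 + (1-q^2)) * ln (1 + (1-q^2)) \<le> (1-q^2) + (1-q^2)^2/2 - (1-q^2)^3/6 + (1-q^2)^4/12"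
    using assms by (intro one_plus_ln_one_plus_le_quartic) (simp add: power_le_one)
  ultimately show ?thesis unfolding B_def C_def by (simp add: algebra_simps)
qed


text \<open>With $e = 1/m$ and $H = 1 - \exp(-m(s+t))$, and up to a negative factor, this is the part depending
  only on $s + t$ of the $m$-derivative of \<open>vertex_gap\<close> (below) at points critical in $(s,t)$.\<close>
definition degree_gain :: "real \<Rightarrow> real \<Rightarrow> real" where
  "degree_gain e H =
    (- ln (1 - H) * (2 + e - H) - (1 + e) * H - (1 + e * H) * ln (1 + e * H) / e) / (1 + e)^2"

text \<open>The second derivative of \<open>degree_gain e\<close> is $H / ((1-H)^2 (1+eH))$, which is visibly decreasing
  in $e$, and both sides vanish to second order at $H = 0$.\<close>
lemma degree_gain_at_one_le:
  fixes e H :: real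
  assumes e: "0 < e" "e \<le> 1" and H: "0 \<le> H" "H < 1"
  shows "degree_gain 1 H \<le> degree_gain e H"
proof -
  define D where "D = (\<lambda>e H::real. ((1 + e) * H / (1 - H) + ln (1 - H) - ln (1 + e * H)) / (1 + e)^2)"
  define DD where "DD = (\<lambda>e H::real. H / ((1 - H)^2 * (1 + e * H)))"
  have D: "((\<lambda>x. degree_gain r x) has_real_derivative D r y) (at y)" if "0 < r" "0 \<le> y" "y < 1" for r y
  proof -
    have [simp]: "1 + r * y > 0" "1 + r * y \<noteq> 0" using that by (auto simp: add_nonneg_eq_0_iff add_pos_nonneg)
    have d1: "((\<lambda>x. - ln (1 - x) * (2 + r - x)) has_real_derivative (2 + r - y) / (1 - y) + ln (1 - y)) (at y)"
      using that by (auto intro!: derivative_eq_intros)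
    have d2: "((\<lambda>x. (1 + r * x) * ln (1 + r * x)) has_real_derivative r * (ln (1 + r * y) + 1)) (at y)"
    proof -
      have "((\<lambda>x. 1 + r * x) has_real_derivative r) (at y)"
        by (auto intro!: derivative_eq_intros)
      moreover have "((\<lambda>x. ln (1 + r * x)) has_real_derivative r / (1 + r * y)) (at y)"
        by (auto intro!: derivative_eq_intros)
      ultimately show ?thesis
        by (rule DERIV_mult[THEN DERIV_cong]) (simp add: distrib_left[of r "ln (1 + r * y)" 1])
    qed
    have "((\<lambda>x. - ln (1 - x) * (2 + r - x) - (1 + r) * x - (1 + r * x) * ln (1 + r * x) / r)
        has_real_derivative (2 + r - y) / (1 - y) + ln (1 - y) - (1 + r) - (ln (1 + r * y) + 1)) (at y)"
      using that by (auto intro!: derivative_eq_intros d1 DERIV_cdivide[OF d2, of r] simp: add_divide_distrib)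
    moreover have "(2 + r - y) / (1 - y) + ln (1 - y) - (1 + r) - (ln (1 + r * y) + 1)
        = (1 + r) * y / (1 - y) + ln (1 - y) - ln (1 + r * y)"
      using that by (simp add: field_simps)
    ultimately show ?thesis
      unfolding degree_gain_def D_def by (intro DERIV_cdivide) simp
  qed
  have DD: "((\<lambda>x. D r x) has_real_derivative DD r y) (at y)" if "0 < r" "0 \<le> y" "y < 1" for r y
  proof -
    have pos: "1 + r * y > 0" "1 + r * y \<noteq> 0" using that by (auto simp: add_nonneg_eq_0_iff add_pos_nonneg)
    have "((\<lambda>x. (1 + r) * x / (1 - x) + ln (1 - x) - ln (1 + r * x))
        has_real_derivative (1 + r) / (1 - y)^2 - 1 / (1 - y) - r / (1 + r * y)) (at y)"
      using that pos by (auto intro!: derivative_eq_intros simp: field_simps power2_eq_square)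
    moreover have "(1 + r) / (1 - y)^2 - 1 / (1 - y) - r / (1 + r * y) = DD r y * (1 + r)^2"
      using that pos unfolding DD_def by (simp add: divide_simps) algebra
    ultimately have "((\<lambda>x. (1 + r) * x / (1 - x) + ln (1 - x) - ln (1 + r * x))
        has_real_derivative DD r y * (1 + r)^2) (at y)" by simp
    then have "((\<lambda>x. D r x) has_real_derivative DD r y * (1 + r)^2 / (1 + r)^2) (at y)"
      unfolding D_def by (rule DERIV_cdivide)
    then show ?thesis using that by simp
  qed
  have "0 \<le> D e y - D 1 y" if y: "0 \<le> y" "y \<le> H" for y
  proof (rule nonneg_if_deriv_nonneg[OF y(1), where f = "\<lambda>x. D e x - D 1 x" and f' = "\<lambda>x. DD e x - DD 1 x"])
    fix x assume x: "0 \<le> x" "x \<le> y"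
    then show "((\<lambda>x. D e x - D 1 x) has_real_derivative DD e x - DD 1 x) (at x)"
      using e y H by (intro DERIV_diff DD) auto
    have "e * x \<le> 1 * x" using e x by (intro mult_right_mono) auto
    then have "(1 - x)^2 * (1 + e * x) \<le> (1 - x)^2 * (1 + 1 * x)" by (intro mult_left_mono) auto
    then show "0 \<le> DD e x - DD 1 x"
      unfolding DD_def using x y H e by (simp add: divide_left_mono add_pos_nonneg)
  qed (simp add: D_def)
  then have "0 \<le> degree_gain e H - degree_gain 1 H"
  proof (intro nonneg_if_deriv_nonneg[OF H(1), where f = "\<lambda>x. degree_gain e x - degree_gain 1 x"
        and f' = "\<lambda>x. D e x - D 1 x"])
    show "((\<lambda>x. degree_gain e x - degree_gain 1 x) has_real_derivative D e y - D 1 y) (at y)"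
      if "0 \<le> y" "y \<le> H" for y
      using that e H by (intro DERIV_diff D) auto
  qed (auto simp: degree_gain_def)
  then show ?thesis by simp
qed

text \<open>Convexity: the second derivative of (2 + x) exp (- x) is x exp (- x). The constant 2 is
  the one produced by expanding the left side of \<open>degree_gain_one_ge\<close>.\<close>

lemma two_plus_times_exp_uminus_midpoint:
  fixes x y :: real
  assumes "0 \<le> x" "0 \<le> y"
  shows "2 * (2 + (x + y) / 2) * exp (- ((x + y) / 2)) \<le> (2 + x) * exp (- x) + (2 + y) * exp (- y)"
proof -
  have "convex_on {0..} (\<lambda>x::real. (2 + x) * exp (- x))"
    by (rule f''_ge0_imp_convex[where f' = "\<lambda>x. - (1 + x) * exp (- x)" and f'' = "\<lambda>x. x * exp (- x)"])
       (auto intro!: derivative_eq_intros simp: algebra_simps)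
  from convex_onD[OF this, of "1/2" x y] show ?thesis
    using assms by (simp add: field_simps)
qed

text \<open>For fixed x + y the right side is constant, while the left side is 2 + (2 + x + y) exp
  (- (x + y)) minus two values of a convex function. So x = y is the worst case, which is
  \<open>diagonal_ineq\<close>.\<close>

lemma degree_gain_one_ge:
  fixes x y :: real
  assumes xy: "0 \<le> x" "0 \<le> y" and I: "I = 1 - exp (- x)" and J: "J = 1 - exp (- y)"
  shows "2 * I * J - x * J * exp (- x) - y * I * exp (- y) \<le> degree_gain 1 (1 - exp (- (x + y)))"
proof -
  define v where "v = (x + y) / 2"
  define q where "q = exp (- v)"
  have v: "v = - ln q" and q: "0 < q" "q \<le> 1" using xy by (auto simp: q_def v_def)
  have e2: "exp (- (x + y)) = q^2" unfolding q_def v_def power2_eq_square mult_exp_exp by (simp add: field_simps)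
  have exy: "exp (- x) * exp (- y) = q^2" using e2 by (simp add: exp_add[symmetric])
  have "2 * I * J - x * J * exp (- x) - y * I * exp (- y)
      = 2 + (2 + x + y) * (exp (- x) * exp (- y)) - ((2 + x) * exp (- x) + (2 + y) * exp (- y))"
    unfolding I J by (simp add: algebra_simps)
  also have "\<dots> \<le> 2 + (2 + 2 * v) * q^2 - 2 * (2 + v) * q"
  proof -
    have "2 + x + y = 2 + 2 * v" by (simp add: v_def)
    then have "(2 + x + y) * q^2 = (2 + 2 * v) * q^2" by simp
    then show ?thesis
      using two_plus_times_exp_uminus_midpoint[OF xy, folded v_def, folded q_def]
      unfolding exy by linarith
  qed
  also have "\<dots> \<le> degree_gain 1 (1 - exp (- (x + y)))"
  proof -
    have "ln (q^2) = - 2 * v" using q by (simp add: v ln_realpow)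
    then show ?thesis
      using diagonal_ineq[OF q] unfolding e2 degree_gain_def v by (simp add: field_simps)
  qed
  finally show ?thesis .
qed

text \<open>At x = ms, y = mt, e = 1/m this makes the numerator in
  \<open>vertex_gap_deriv_degree\<close> negative. Since - (1 - u) ln (1 - u) < u, the logarithm on
  the left contributes less than a second I * J, which removes e from that side; monotonicity in e
  then reduces the right side to e = 1. Strictness is what excludes every m < d.\<close>

lemma degree_gain_gt:
  fixes x y e :: real
  assumes xy: "0 < x" "0 < y" and e: "0 < e" "e \<le> 1"
    and I: "I = 1 - exp (- x)" and J: "J = 1 - exp (- y)"
  shows "I * J - x * J * exp (- x) - y * I * exp (- y) - (1 - e * (I * J)) * ln (1 - e * (I * J)) / e
    < degree_gain e (1 - exp (- (x + y)))"
proof -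
  define u where "u = e * (I * J)"
  have IJ: "0 < I" "I < 1" "0 < J" "J < 1" using xy by (auto simp: I J)
  then have "0 < I * J" "I * J < 1" using mult_strict_mono[of I 1 J 1] by auto
  moreover have "u \<le> 1 * (I * J)" unfolding u_def using e \<open>0 < I * J\<close> by (intro mult_right_mono) auto
  ultimately have u: "0 < u" "u < 1" using e by (auto simp: u_def)
  have "ln (1 / (1 - u)) < 1 / (1 - u) - 1"
  proof -
    have "1 / (1 - u) \<noteq> 1" using u by auto
    then show ?thesis using u ln_le_minus_one[of "1 / (1 - u)"] ln_eq_minus_one[of "1 / (1 - u)"] by force
  qed
  then have "- (1 - u) * ln (1 - u) < u" using u by (simp add: ln_div field_simps)
  then have "- (1 - u) * ln (1 - u) / e < u / e" using e by (intro divide_strict_right_mono)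
  also have "u / e = I * J" using e by (simp add: u_def)
  also have "- (1 - u) * ln (1 - u) / e = - ((1 - u) * ln (1 - u) / e)"
    by (simp only: mult_minus_left minus_divide_left)
  finally have "I * J - x * J * exp (- x) - y * I * exp (- y) - (1 - u) * ln (1 - u) / e
      < 2 * I * J - x * J * exp (- x) - y * I * exp (- y)" by simp
  also have "\<dots> \<le> degree_gain 1 (1 - exp (- (x + y)))"
    using degree_gain_one_ge xy I J by simp
  also have "\<dots> \<le> degree_gain e (1 - exp (- (x + y)))"
    using e xy by (intro degree_gain_at_one_le) auto
  finally show ?thesis unfolding u_def .
qed

section \<open>Minimizing the contribution of one neighbour\<close>

text \<open>For a vertex of degree $m$ with weights $l, k$ put $s = \ln(1+ml)/m$ and $t = \ln(1+mk)/m$. Then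
  \<open>vertex_gap w1 w2 m s t\<close> is the contribution of this vertex to the neighbourhood inequality after
  weighted AM-GM with weights $1-w_1-w_2, w_1, w_2$ (see \<open>ln_clique_root_combination\<close>). These
  coordinates make sense for real $m$.\<close>
definition vertex_gap :: "real \<Rightarrow> real \<Rightarrow> real \<Rightarrow> real \<Rightarrow> real \<Rightarrow> real" where
  "vertex_gap w1 w2 m s t =
    (1 - w1 - w2) / m * ln (1 - (1 - exp (- (m * s))) * (1 - exp (- (m * t))) / m)
    + (s + t - ln (1 + (1 - exp (- (m * (s + t)))) / m)) / (m + 1) - w1 * s - w2 * t"

lemma vertex_gap_commute: "vertex_gap w1 w2 m s t = vertex_gap w2 w1 m t s"
  by (simp add: vertex_gap_def algebra_simps)

section \<open>Positive arguments of the logarithms and partial derivatives of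
  \<open>vertex_gap\<close>\<close>

lemma has_real_derivative_ln:
  assumes "(f has_real_derivative D) (at x)" and "0 < f x"
  shows "((\<lambda>x. ln (f x)) has_real_derivative D / f x) (at x)"
  using assms by (auto intro!: derivative_eq_intros)

lemma one_minus_exp_bounds:
  fixes m s :: real
  assumes "1 \<le> m" "0 \<le> s"
  shows "0 \<le> 1 - exp (- (m * s))" "1 - exp (- (m * s)) < 1"
  using assms by auto

lemma exp_product_less_one:
  fixes m s t :: real
  assumes "1 \<le> m" "0 \<le> s" "0 \<le> t"
  shows "0 < 1 - (1 - exp (- (m * s))) * (1 - exp (- (m * t))) / m"
proof -
  have "(1 - exp (- (m * s))) * (1 - exp (- (m * t))) < 1"
    using mult_strict_mono'[of "1 - exp (- (m * s))" 1 "1 - exp (- (m * t))" 1] one_minus_exp_bounds assms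
    by auto
  then show ?thesis using assms by (simp add: field_simps)
qed

lemma one_plus_exp_pos:
  fixes m s :: real
  assumes "1 \<le> m" "0 \<le> s"
  shows "0 < 1 + (1 - exp (- (m * s))) / m"
  using one_minus_exp_bounds[OF assms] assms by (intro add_pos_nonneg divide_nonneg_nonneg) auto

text \<open>Since 1 - H = (1 - I) (1 - J), all exponentials are expressed by I and J, and
  stationarity becomes an algebraic condition.\<close>

lemma vertex_gap_deriv_left:
  fixes m s t :: real
  assumes m: "1 \<le> m" and st: "0 \<le> s" "0 \<le> t"
    and I: "I = 1 - exp (- (m * s))" and J: "J = 1 - exp (- (m * t))" and H: "H = I + J - I * J"
  shows "((\<lambda>s. vertex_gap w1 w2 m s t) has_real_derivative
    H / (m + H) - (1 - w1 - w2) * (1 - I) * J / (m - I * J) - w1) (at s)"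
proof -
  have H': "1 - exp (- (m * (s + t))) = H"
    unfolding H I J by (simp add: exp_add[symmetric] algebra_simps)
  have pos: "0 < 1 - I * J / m" "0 < 1 + H / m"
    using exp_product_less_one[OF m st] one_plus_exp_pos[of m "s + t"] m st by (auto simp: I J H')
  have d1: "((\<lambda>s. ln (1 - (1 - exp (- (m * s))) * J / m)) has_real_derivative
      - ((1 - I) * J) / (1 - I * J / m)) (at s)"
    using pos m unfolding I by (auto intro!: derivative_eq_intros)
  have d2: "((\<lambda>s. ln (1 + (1 - exp (- (m * (s + t)))) / m)) has_real_derivative
      (1 - H) / (1 + H / m)) (at s)"
    using pos m unfolding H'[symmetric] by (auto intro!: derivative_eq_intros)
  have d3: "((\<lambda>s. s + t - ln (1 + (1 - exp (- (m * (s + t)))) / m)) has_real_derivative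
      1 - (1 - H) / (1 + H / m)) (at s)"
    by (rule DERIV_diff[OF _ d2]) (auto intro!: derivative_eq_intros)
  have d4: "((\<lambda>s. w1 * s) has_real_derivative w1) (at s)"
    by (auto intro!: derivative_eq_intros)
  have "((\<lambda>s. vertex_gap w1 w2 m s t) has_real_derivative
      (1 - w1 - w2) / m * (- ((1 - I) * J) / (1 - I * J / m)) + (1 - (1 - H) / (1 + H / m)) / (m + 1) - w1 - 0) (at s)"
    unfolding vertex_gap_def J[symmetric]
    by (intro DERIV_add DERIV_diff DERIV_cmult DERIV_cdivide d1 d3 d4 DERIV_const)
  \<comment> \<open>The factor m + 1 cancels: 1 - (1 - H) / (1 + H / m) = (m + 1) H / (m +
    H).\<close>
  moreover have "(1 - (1 - H) / (1 + H / m)) / (m + 1) = H / (m + H)"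
  proof -
    have "m + H \<noteq> 0" "m \<noteq> 0" "m + 1 \<noteq> 0" using pos m by (auto simp: field_simps)
    then show ?thesis by (simp add: divide_simps) algebra
  qed
  moreover have "(1 - w1 - w2) / m * (- ((1 - I) * J) / (1 - I * J / m))
      = - ((1 - w1 - w2) * (1 - I) * J / (m - I * J))"
  proof -
    have "m - I * J \<noteq> 0" "m \<noteq> 0" using pos m by (auto simp: field_simps)
    then show ?thesis by (simp add: divide_simps) 
  qed
  ultimately show ?thesis by simp
qed

lemma vertex_gap_deriv_right:
  fixes m s t :: real
  assumes m: "1 \<le> m" and st: "0 \<le> s" "0 \<le> t"
    and I: "I = 1 - exp (- (m * s))" and J: "J = 1 - exp (- (m * t))" and H: "H = I + J - I * J"
  shows "((\<lambda>t. vertex_gap w1 w2 m s t) has_real_derivative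
    H / (m + H) - (1 - w1 - w2) * (1 - J) * I / (m - I * J) - w2) (at t)"
proof -
  have "H = J + I - J * I" "1 - w2 - w1 = 1 - w1 - w2" "J * I = I * J" using H by simp_all
  with vertex_gap_deriv_left[OF m st(2,1) J I, of H w2 w1] show ?thesis
    unfolding vertex_gap_commute[of w2 w1] by metis
qed

text \<open>The hypothesis on the weights holds at every critical point in $(s,t)$.\<close>
lemma vertex_gap_deriv_degree:
  fixes m s t :: real
  assumes m: "1 \<le> m" and st: "0 \<le> s" "0 \<le> t"
    and I: "I = 1 - exp (- (m * s))" and J: "J = 1 - exp (- (m * t))" and H: "H = I + J - I * J"
    and w: "1 - w1 - w2 = (m - I * J) / (m + H)"
  shows "((\<lambda>m. vertex_gap w1 w2 m s t) has_real_derivative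
    (I * J - m * s * J * (1 - I) - m * t * I * (1 - J) - (1 - 1 / m * (I * J)) * ln (1 - 1 / m * (I * J)) / (1 / m)
      - degree_gain (1 / m) H) / (m^2 * (m + H))) (at m)"
proof -
  have H': "1 - exp (- (m * (s + t))) = H"
    unfolding H I J by (simp add: exp_add[symmetric] algebra_simps)
  have pos: "0 < 1 - I * J / m" "0 < 1 + H / m"
    using exp_product_less_one[OF m st] one_plus_exp_pos[of m "s + t"] m st by (auto simp: I J H')
  \<comment> \<open>Naming the two logarithms turns them into atoms; with \<open>w\<close> and
    \<open>ln_H\<close> the final identity is purely rational.\<close>
  define U where "U = ln (1 - I * J / m)"
  define W where "W = ln (1 + H / m)"
  have d1: "((\<lambda>m. ln (1 - (1 - exp (- (m * s))) * (1 - exp (- (m * t))) / m)) has_real_derivative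
      - ((s * (1 - I) * J + t * I * (1 - J)) / m - I * J / m^2) / (1 - I * J / m)) (at m)"
  proof -
    have "((\<lambda>m. 1 - (1 - exp (- (m * s))) * (1 - exp (- (m * t))) / m) has_real_derivative
        - ((s * (1 - I) * J + t * I * (1 - J)) / m - I * J / m^2)) (at m)"
      using m unfolding I J by (auto intro!: derivative_eq_intros simp: field_simps power2_eq_square)
    from has_real_derivative_ln[OF this] show ?thesis
      using pos unfolding I[symmetric] J[symmetric] by simp
  qed
  have d2: "((\<lambda>m. ln (1 + (1 - exp (- (m * (s + t)))) / m)) has_real_derivative
      ((s + t) * (1 - H) / m - H / m^2) / (1 + H / m)) (at m)"
  proof -
    have "((\<lambda>m. 1 + (1 - exp (- (m * (s + t)))) / m) has_real_derivative
        ((s + t) * (1 - H) / m - H / m^2)) (at m)"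
      using m unfolding H'[symmetric] by (auto intro!: derivative_eq_intros simp: field_simps power2_eq_square)
    from has_real_derivative_ln[OF this] show ?thesis
      using pos unfolding H' by simp
  qed
  have d3: "((\<lambda>m. (1 - w1 - w2) / m) has_real_derivative - (1 - w1 - w2) / m^2) (at m)"
    using m by (auto intro!: derivative_eq_intros simp: power2_eq_square)
  have d4: "((\<lambda>m. m + 1) has_real_derivative 1) (at m)"
    by (auto intro!: derivative_eq_intros)
  have "m + 1 \<noteq> 0" using m by simp
  note d5 = DERIV_add[OF DERIV_mult[OF d3 d1]
      DERIV_divide[OF DERIV_diff[OF DERIV_const[of "s + t"] d2] d4 this]]
  have d: "((\<lambda>m. vertex_gap w1 w2 m s t) has_real_derivative
     - (1 - w1 - w2) / m^2 * U
      + - ((s * (1 - I) * J + t * I * (1 - J)) / m - I * J / m^2) / (1 - I * J / m) * ((1 - w1 - w2) / m)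
      + ((0 - ((s + t) * (1 - H) / m - H / m^2) / (1 + H / m)) * (m + 1) - (s + t - W) * 1) / ((m + 1) * (m + 1))
      - 0 - 0) (at m)"
    unfolding vertex_gap_def
    by (intro DERIV_diff DERIV_const d5[unfolded I[symmetric] J[symmetric] H', folded U_def W_def])
  have ln_H: "ln (1 - H) = - (m * (s + t))" unfolding H'[symmetric] by simp
  have nz: "m \<noteq> 0" "m + 1 \<noteq> 0" "m - I * J \<noteq> 0" "m + H \<noteq> 0" "1 + m \<noteq> 0" using pos m by (auto simp: field_simps)
  have f: "1 - I * J / m = (m - I * J) / m" "1 + H / m = (m + H) / m" using nz by (auto simp: field_simps)
  have U': "ln (1 - 1 / m * (I * J)) = U" and W': "ln (1 + 1 / m * H) = W" by (simp_all add: U_def W_def)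
  show ?thesis
  proof (rule DERIV_cong[OF d])
    show "- (1 - w1 - w2) / m^2 * U
      + - ((s * (1 - I) * J + t * I * (1 - J)) / m - I * J / m^2) / (1 - I * J / m) * ((1 - w1 - w2) / m)
      + ((0 - ((s + t) * (1 - H) / m - H / m^2) / (1 + H / m)) * (m + 1) - (s + t - W) * 1) / ((m + 1) * (m + 1))
      - 0 - 0
      = (I * J - m * s * J * (1 - I) - m * t * I * (1 - J) - (1 - 1 / m * (I * J)) * ln (1 - 1 / m * (I * J)) / (1 / m)
      - degree_gain (1 / m) H) / (m^2 * (m + H))"
      unfolding w degree_gain_def U' W' ln_H f using nz
      by (simp add: divide_simps) algebra
  qed
qed

section \<open>First-order conditions and the location of the minimizer\<close>

lemma deriv_nonneg_if_min_right:
  fixes f :: "real \<Rightarrow> real"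
  assumes "(f has_real_derivative D) (at x)" "x < b" "\<And>y. x \<le> y \<Longrightarrow> y \<le> b \<Longrightarrow> f x \<le> f y"
  shows "0 \<le> D"
proof (rule ccontr)
  assume "\<not> 0 \<le> D"
  then obtain d where d: "d > 0" "\<And>h. 0 < h \<Longrightarrow> h < d \<Longrightarrow> f (x + h) < f x"
    using DERIV_neg_dec_right[OF assms(1)] by auto
  define h where "h = min (d / 2) (b - x)"
  have "0 < h" "h < d" "x + h \<le> b" using d(1) assms(2) by (auto simp: h_def)
  then show False using d(2)[of h] assms(3)[of "x + h"] by force
qed

lemma deriv_nonpos_if_min_left:
  fixes f :: "real \<Rightarrow> real"
  assumes "(f has_real_derivative D) (at x)" "a < x" "\<And>y. a \<le> y \<Longrightarrow> y \<le> x \<Longrightarrow> f x \<le> f y"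
  shows "D \<le> 0"
proof (rule ccontr)
  assume "\<not> D \<le> 0"
  then obtain d where d: "d > 0" "\<And>h. 0 < h \<Longrightarrow> h < d \<Longrightarrow> f (x - h) < f x"
    using DERIV_pos_inc_left[OF assms(1)] by auto
  define h where "h = min (d / 2) (x - a)"
  have "0 < h" "h < d" "a \<le> x - h" using d(1) assms(2) by (auto simp: h_def)
  then show False using d(2)[of h] assms(3)[of "x - h"] by force
qed

lemma vertex_gap_continuous:
  "continuous_on ({1..d} \<times> {0..K} \<times> {0..K}) (\<lambda>(m, s, t). vertex_gap w1 w2 m s t)"
proof -
  let ?S = "{1..d} \<times> {0..K} \<times> {0..K}"
  have "\<forall>p\<in>?S. 1 - (1 - exp (- (fst p * fst (snd p)))) * (1 - exp (- (fst p * snd (snd p)))) / fst p \<noteq> 0"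
    by (rule ballI, rule less_imp_neq[symmetric], rule exp_product_less_one) auto
  moreover have "\<forall>p\<in>?S. 1 + (1 - exp (- (fst p * (fst (snd p) + snd (snd p))))) / fst p \<noteq> 0"
    by (rule ballI, rule less_imp_neq[symmetric], rule one_plus_exp_pos) auto
  moreover have "\<forall>p\<in>?S. fst p \<noteq> 0" "\<forall>p\<in>?S. fst p + 1 \<noteq> 0" by auto
  ultimately show ?thesis
    unfolding vertex_gap_def case_prod_unfold by (intro continuous_intros)
qed

text \<open>The partial derivatives in $s$ and $t$ add up to
  $(m-H)\,((1-w_1-w_2)/(m-IJ) - 1/(m+H))$. If both are nonpositive, then $m-IJ$ is bounded
  away from $0$, and this forces the derivative in $s$ to be positive far out.\<close>
lemma gap_upper_boundary:
  fixes m d s t w1 w2 :: real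
  assumes m: "1 \<le> m" "m \<le> d" and st: "0 \<le> s" "0 \<le> t"
    and I: "I = 1 - exp (- (m * s))" and J: "J = 1 - exp (- (m * t))" and H: "H = I + J - I * J"
    and w: "0 \<le> 1 - w1 - w2" "1 - w1 - w2 \<le> 1"
    and far: "w1 < (1 - exp (- s)) / (d + 1) - exp (- s)"
    and ds: "H / (m + H) - (1 - w1 - w2) * (1 - I) * J / (m - I * J) - w1 \<le> 0"
    and dt: "0 < t \<Longrightarrow> H / (m + H) - (1 - w1 - w2) * (1 - J) * I / (m - I * J) - w2 \<le> 0"
  shows False
proof -
  have IJ: "0 \<le> I" "I < 1" "0 \<le> J" "J < 1"
    unfolding I J using one_minus_exp_bounds m(1) st by auto
  have "I * J < 1" using mult_strict_mono'[of I 1 J 1] IJ by simp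
  have H': "H = 1 - (1 - I) * (1 - J)" unfolding H by (simp add: algebra_simps)
  have "0 < (1 - I) * (1 - J)" using IJ by simp
  then have H1: "H < 1" unfolding H' by simp
  have HI: "I \<le> H" unfolding H using mult_right_mono[of I 1 J] IJ by simp
  define A where "A = m - I * J"
  define B where "B = m + H"
  have A: "0 < A" and B: "0 < B" "m \<le> B" using \<open>I * J < 1\<close> m HI IJ by (auto simp: A_def B_def)
  \<comment> \<open>Uniform in m, because m >= 1.\<close>
  have E: "1 - I \<le> exp (- s)"
    unfolding I using m(1) st mult_right_mono[of 1 m s] by simp
  \<comment> \<open>At t = 0 minimality gives no upper bound on the t-derivative, but then J = 0 and
    the term vanishes.\<close>
  have mid: "(1 - w1 - w2) * (1 - I) * J / A \<le> exp (- s)"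
  proof (cases "t = 0")
    case True
    then show ?thesis by (simp add: J)
  next
    case False
    then have "H / B - (1 - w1 - w2) * (1 - I) * J / A - w1 + (H / B - (1 - w1 - w2) * (1 - J) * I / A - w2) \<le> 0"
      using ds dt st unfolding A_def B_def by linarith
    also have "H / B - (1 - w1 - w2) * (1 - I) * J / A - w1 + (H / B - (1 - w1 - w2) * (1 - J) * I / A - w2)
        = (m - H) * ((1 - w1 - w2) / A - 1 / B)"
    proof -
      have "m - I * J \<noteq> 0" "m + (I + J - I * J) \<noteq> 0" using A B by (auto simp: A_def B_def H)
      then show ?thesis unfolding A_def B_def H by (simp add: divide_simps) algebra
    qed
    finally have "(1 - w1 - w2) / A \<le> 1 / B"
      using H1 m by (simp add: mult_le_0_iff)
    also have "1 / B \<le> 1" using B m by simp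
    finally have "(1 - w1 - w2) / A \<le> 1" .
    moreover have "(1 - I) * J \<le> (1 - I) * 1" using IJ by (intro mult_left_mono) auto
    moreover have "0 \<le> (1 - w1 - w2) / A" using w A by simp
    ultimately have "(1 - w1 - w2) / A * ((1 - I) * J) \<le> 1 * (1 - I)"
      using IJ by (intro mult_mono) auto
    then show ?thesis using E by simp
  qed
  have "(1 - exp (- s)) / (d + 1) \<le> I / (d + 1)"
    using E m by (intro divide_right_mono) auto
  also have "\<dots> \<le> I / (m + I)" using IJ m by (intro divide_left_mono) auto
  also have "\<dots> \<le> H / (m + H)" using HI IJ m by (simp add: field_simps)
  finally show False using mid ds far unfolding A_def by linarith
qed

text \<open>The face s = 0, where I = 0 and H = J. If t = 0, the s-derivative is - w1 < 0. Otherwise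
  stationarity in t gives J / m = w2 / (1 - w2), and the s-derivative becomes - w1 (1 - 2 w2) / (1 -
  w2), negative because w2 < 1/2. Either way, increasing s lowers the gap.\<close>

lemma gap_lower_boundary:
  fixes m t w1 w2 :: real
  assumes m: "1 \<le> m" and t: "0 \<le> t" and J: "J = 1 - exp (- (m * t))"
    and w: "0 < w1" "0 < w2" "w2 < 1/2"
    and ds: "0 \<le> J / (m + J) - (1 - w1 - w2) * J / m - w1"
    and dt: "0 < t \<Longrightarrow> J / (m + J) - w2 = 0"
  shows False
proof (cases "t = 0")
  case True
  then show False using ds w by (simp add: J)
next
  case False
  have Jp: "0 \<le> J" using one_minus_exp_bounds[OF m t] by (simp add: J)
  have eq: "J / (m + J) = w2" using False t dt by simp
  then have "J * (1 - w2) = w2 * m" using Jp m by (simp add: field_simps)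
  then have "J / m = w2 / (1 - w2)" using w m by (simp add: field_simps)
  then have "0 \<le> w2 - (1 - w1 - w2) * (w2 / (1 - w2)) - w1"
    using ds eq by (metis times_divide_eq_right)
  also have "\<dots> = - (w1 * (1 - 2 * w2) / (1 - w2))"
    using w by (simp add: divide_simps) algebra
  also have "\<dots> < 0" using w by simp
  finally show False by simp
qed

lemma exp_uminus_injective:
  fixes d s s' :: real
  assumes "1 - exp (- (d * s)) = 1 - exp (- (d * s'))" "d \<noteq> 0"
  shows "s = s'"
  using assms by simp

text \<open>A minimizer over the compact box $[1,d] \times [0,K]^2$ cannot have $s$ or $t$ on the boundary,
  so it is critical in $(s,t)$. There the derivative in $m$ is negative, whence $m = d$. For
  $m = d$ the critical point is unique: $w_1 = I/B$ and $w_2 = J/B$ turn the definition of $B = d+H$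
  into a quadratic equation for $B$ with only one positive root.\<close>
lemma vertex_gap_minimum:
  fixes d m s t s0 t0 :: real
  assumes d: "1 \<le> d" and st0: "0 < s0" "0 < t0" and m: "1 \<le> m" "m \<le> d" and st: "0 \<le> s" "0 \<le> t"
    and I0: "I0 = 1 - exp (- (d * s0))" and J0: "J0 = 1 - exp (- (d * t0))"
    and w1: "w1 = I0 / (d + (I0 + J0 - I0 * J0))" and w2: "w2 = J0 / (d + (I0 + J0 - I0 * J0))"
  shows "vertex_gap w1 w2 d s0 t0 \<le> vertex_gap w1 w2 m s t"
proof -
  define B0 where "B0 = d + (I0 + J0 - I0 * J0)"
  have IJ0: "0 < I0" "I0 < 1" "0 < J0" "J0 < 1"
    using d st0 by (auto simp: I0 J0)
  have IJ0': "I0 * J0 < I0" "I0 * J0 < J0"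
    using IJ0 mult_strict_left_mono[of J0 1 I0] mult_strict_right_mono[of I0 1 J0] by auto
  have B0: "0 < B0" using d IJ0 IJ0' unfolding B0_def by linarith
  have w: "0 < w1" "0 < w2" using IJ0 B0 by (auto simp: w1 w2 B0_def)
  have w0: "1 - w1 - w2 = (d - I0 * J0) / B0"
  proof -
    have "w1 * B0 = I0" "w2 * B0 = J0" using B0 unfolding w1 w2 B0_def[symmetric] by simp_all
    then have "(1 - w1 - w2) * B0 = d - I0 * J0" by (simp add: left_diff_distrib) (simp add: B0_def)
    then show ?thesis using B0 by (simp add: field_simps)
  qed
  have w0p: "0 < 1 - w1 - w2"
    unfolding w0 by (rule divide_pos_pos) (use d IJ0 IJ0' B0 in linarith)+
  \<comment> \<open>The bound (1 - exp (- s)) / (d + 1) - exp (- s) of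
    \<open>gap_upper_boundary\<close> tends to 1 / (d + 1), so strictness leaves room for a finite
    box. As d >= 1, it also yields the bound 1/2 for \<open>gap_lower_boundary\<close>.\<close>
  have wd: "w1 < 1 / (d + 1)" "w2 < 1 / (d + 1)"
  proof -
    have "d * I0 \<le> d * 1" "d * J0 \<le> d * 1" using IJ0 d by (auto intro: mult_left_mono)
    then have "I0 * (d + 1) < B0" "J0 * (d + 1) < B0"
      using IJ0' unfolding B0_def distrib_left by (simp_all add: mult.commute)
    then show "w1 < 1 / (d + 1)" "w2 < 1 / (d + 1)"
      unfolding w1 w2 B0_def[symmetric] using d B0 by (auto simp: field_simps)
  qed
  have "1 / (d + 1) \<le> 1 / 2" using d by (intro divide_left_mono) auto
  then have wh: "w1 < 1/2" "w2 < 1/2" using wd by auto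
  define eps where "eps = min (1 / (d + 1) - w1) (1 / (d + 1) - w2) / 2"
  have eps: "0 < eps" "w1 \<le> 1 / (d + 1) - 2 * eps" "w2 \<le> 1 / (d + 1) - 2 * eps"
    using wd by (auto simp: eps_def min_def)
  \<comment> \<open>The entry \<open>1 - ln eps\<close> gives exp (- K) < eps, so the two error
    terms in \<open>far\<close> fit into the slack 2 * eps; the other entries put the comparison
    point (m, s, t) into the box and make K positive.\<close>
  define K where "K = max (1 - ln eps) (max (max s t) (max s0 t0))"
  have K: "s \<le> K" "t \<le> K" "s0 \<le> K" "t0 \<le> K" "0 < K" using st0 by (auto simp: K_def)
  have "exp (- K) < eps"
  proof -
    have "- K < ln eps" unfolding K_def by simp
    then have "exp (- K) < exp (ln eps)" by (simp only: exp_less_cancel_iff)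
    then show ?thesis using eps by simp
  qed
  moreover have "exp (- K) / (d + 1) \<le> exp (- K)" using d by (simp add: field_simps)
  ultimately have far: "w1 < (1 - exp (- K)) / (d + 1) - exp (- K)" "w2 < (1 - exp (- K)) / (d + 1) - exp (- K)"
    using eps by (auto simp: diff_divide_distrib)
  let ?S = "{1..d} \<times> {0..K} \<times> {0..K}"
  have "compact ?S" by (intro compact_Times compact_Icc)
  moreover have "?S \<noteq> {}" using d K by auto
  ultimately obtain p where p: "p \<in> ?S"
    and min': "\<forall>q\<in>?S. (case p of (m, s, t) \<Rightarrow> vertex_gap w1 w2 m s t) \<le> (case q of (m, s, t) \<Rightarrow> vertex_gap w1 w2 m s t)"
    using continuous_attains_inf[OF _ _ vertex_gap_continuous] by metis
  obtain n u v where puv: "p = (n, u, v)" by (metis prod_cases3)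
  have n: "1 \<le> n" "n \<le> d" and u: "0 \<le> u" "u \<le> K" and v: "0 \<le> v" "v \<le> K" using p puv by auto
  have min: "vertex_gap w1 w2 n u v \<le> vertex_gap w1 w2 n' u' v'"
    if "1 \<le> n'" "n' \<le> d" "0 \<le> u'" "u' \<le> K" "0 \<le> v'" "v' \<le> K" for n' u' v'
    using bspec[OF min', of "(n', u', v')"] that puv by auto
  define I where "I = 1 - exp (- (n * u))"
  define J where "J = 1 - exp (- (n * v))"
  define H where "H = I + J - I * J"
  define U where "U = H / (n + H) - (1 - w1 - w2) * (1 - I) * J / (n - I * J) - w1"
  define V where "V = H / (n + H) - (1 - w1 - w2) * (1 - J) * I / (n - I * J) - w2"
  note dU = vertex_gap_deriv_left[OF n(1) u(1) v(1) I_def J_def H_def, of w1 w2, folded U_def]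
  note dV = vertex_gap_deriv_right[OF n(1) u(1) v(1) I_def J_def H_def, of w1 w2, folded V_def]
  \<comment> \<open>On a face of the box minimality yields only one of the two signs, so the faces
    are excluded separately before U = V = 0 is concluded.\<close>
  have Unonneg: "0 \<le> U" if "u < K" using deriv_nonneg_if_min_right[OF dU that] min n u v by auto
  have Vnonneg: "0 \<le> V" if "v < K" using deriv_nonneg_if_min_right[OF dV that] min n u v by auto
  have Unonpos: "U \<le> 0" if "0 < u" using deriv_nonpos_if_min_left[OF dU that] min n u v by auto
  have Vnonpos: "V \<le> 0" if "0 < v" using deriv_nonpos_if_min_left[OF dV that] min n u v by auto
  have "u \<noteq> K"
    using gap_upper_boundary[OF n u(1) v(1) I_def J_def H_def, of w1 w2] w w0p far Unonpos Vnonpos K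
    unfolding U_def V_def by auto
  moreover have "v \<noteq> K"
    using gap_upper_boundary[OF n v(1) u(1) J_def I_def, of H w2 w1] w w0p far Unonpos Vnonpos K
    unfolding U_def V_def H_def by (auto simp: algebra_simps)
  ultimately have lt: "u < K" "v < K" using u v by auto
  have "u \<noteq> 0"
  proof
    assume "u = 0"
    then have "I = 0" by (simp add: I_def)
    then show False
      using gap_lower_boundary[OF n(1) v(1) J_def w wh(2)] Unonneg Vnonneg Vnonpos lt
      unfolding U_def V_def H_def by force
  qed
  moreover have "v \<noteq> 0"
  proof
    assume "v = 0"
    then have "J = 0" by (simp add: J_def)
    then have "U = I / (n + I) - w1" "V = I / (n + I) - (1 - w2 - w1) * I / n - w2"
      by (simp_all add: U_def V_def H_def)
    then show False
      using gap_lower_boundary[OF n(1) u(1) I_def w(2,1) wh(1)] Unonneg Vnonneg Unonpos lt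
      by force
  qed
  ultimately have pos: "0 < u" "0 < v" using u v by auto
  then have UV: "U = 0" "V = 0" using Unonneg Vnonneg Unonpos Vnonpos lt by force+
  have IJ: "0 < I" "I < 1" "0 < J" "J < 1" using pos n by (auto simp: I_def J_def)
  have IJ': "I * J < I" "I * J < J"
    using IJ mult_strict_left_mono[of J 1 I] mult_strict_right_mono[of I 1 J] by auto
  define B where "B = n + H"
  have A: "0 < n - I * J" and B: "0 < B" using n IJ IJ' unfolding B_def H_def by linarith+
  have H1: "H < 1"
  proof -
    have "0 < (1 - I) * (1 - J)" using IJ by simp
    then show ?thesis by (simp add: H_def algebra_simps)
  qed
  \<comment> \<open>Adding both stationarity equations leaves a product whose factor n - H is
    positive, since H < 1 <= n.\<close>
  have crit0: "1 - w1 - w2 = (n - I * J) / B"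
  proof -
    have "U + V = (n - H) * ((1 - w1 - w2) / (n - I * J) - 1 / B)"
    proof -
      have "n - I * J \<noteq> 0" "n + (I + J - I * J) \<noteq> 0" using A B by (auto simp: B_def H_def)
      then show ?thesis unfolding U_def V_def B_def H_def by (simp add: divide_simps) algebra
    qed
    then have "(1 - w1 - w2) / (n - I * J) = 1 / B" using UV H1 n by simp
    then show ?thesis using A B by (simp add: field_simps)
  qed
  \<comment> \<open>Uses H - (1 - I) J = I and H - (1 - J) I = J.\<close>
  have crit: "w1 = I / B" "w2 = J / B"
  proof -
    have "(n - I * J) / B * (1 - I) * J / (n - I * J) = (1 - I) * J / B"
      "(n - I * J) / B * (1 - J) * I / (n - I * J) = (1 - J) * I / B"
      using A by simp_all
    then have "w1 = H / B - (1 - I) * J / B" "w2 = H / B - (1 - J) * I / B"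
      using UV unfolding U_def V_def crit0 B_def[symmetric] by linarith+
    then show "w1 = I / B" "w2 = J / B"
      unfolding diff_divide_distrib[symmetric] H_def by (simp_all add: algebra_simps)
  qed
  have "n = d"
  proof (rule ccontr)
    assume "n \<noteq> d"
    then have "n < d" using n by simp
    note dn = vertex_gap_deriv_degree[OF n(1) u(1) v(1) I_def J_def H_def crit0[unfolded B_def]]
    have "0 \<le> (I * J - n * u * J * (1 - I) - n * v * I * (1 - J)
        - (1 - 1 / n * (I * J)) * ln (1 - 1 / n * (I * J)) / (1 / n) - degree_gain (1 / n) H) / (n^2 * (n + H))"
      by (rule deriv_nonneg_if_min_right[OF dn \<open>n < d\<close>]) (use min n u v in auto)
    moreover have "I * J - n * u * J * (1 - I) - n * v * I * (1 - J)
        - (1 - 1 / n * (I * J)) * ln (1 - 1 / n * (I * J)) / (1 / n) < degree_gain (1 / n) H"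
    proof -
      have "1 - exp (- (n * u + n * v)) = H"
        unfolding H_def I_def J_def by (simp add: exp_add[symmetric] algebra_simps)
      then show ?thesis
        using degree_gain_gt[of "n * u" "n * v" "1 / n" I J] pos n unfolding I_def J_def by simp
    qed
    moreover have "0 < n^2 * (n + H)" using B n unfolding B_def by (intro mult_pos_pos) auto
    ultimately show False using divide_neg_pos by (metis diff_less_0_iff_less not_less)
  qed
  have "B = B0"
  proof -
    have "B = d + (w1 * B + w2 * B - w1 * w2 * B^2)"
      using B crit by (simp add: power2_eq_square) (simp add: B_def H_def \<open>n = d\<close>)
    moreover have "B0 = d + (w1 * B0 + w2 * B0 - w1 * w2 * B0^2)"
      using B0 w1 w2 unfolding B0_def[symmetric] by (simp add: power2_eq_square) (simp add: B0_def)
    ultimately have "(B - B0) * ((1 - w1 - w2) + w1 * w2 * (B + B0)) = 0"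
      by (simp add: algebra_simps power2_eq_square)
    moreover have "0 < (1 - w1 - w2) + w1 * w2 * (B + B0)"
      using w0p w B B0 by (intro add_pos_pos) auto
    ultimately show ?thesis by simp
  qed
  then have "I / B0 = I0 / B0" "J / B0 = J0 / B0"
    using crit w1 w2 unfolding B0_def[symmetric] by metis+
  then have "I = I0" "J = J0" using B0 by (metis divide_cancel_right less_irrefl)+
  then have "1 - exp (- (d * u)) = 1 - exp (- (d * s0))" "1 - exp (- (d * v)) = 1 - exp (- (d * t0))"
    unfolding I_def J_def I0 J0 \<open>n = d\<close> by simp_all
  then have "u = s0" "v = t0"
    using d by (auto intro: exp_uminus_injective)
  then show ?thesis using min[OF m st(1) K(1) st(2) K(2)] \<open>n = d\<close> by simp
qed

section \<open>The neighbourhood inequality\<close>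

text \<open>The index is the degree of a vertex: this is the partition function of the complete
  graph on d + 1 vertices.\<close>

definition clique_poly :: "nat \<Rightarrow> real \<Rightarrow> real \<Rightarrow> real" where
  "clique_poly d l k = (real d + 1) * real d * l * k + (real d + 1) * (l + k) + 1"

definition clique_root :: "nat \<Rightarrow> real \<Rightarrow> real \<Rightarrow> real" where
  "clique_root d l k = clique_poly d l k powr (1 / (real d + 1))"

lemma clique_poly_ge_one:
  assumes "0 \<le> l" "0 \<le> k"
  shows "1 \<le> clique_poly d l k"
  using assms by (simp add: clique_poly_def)

lemma clique_root_pos:
  assumes "0 \<le> l" "0 \<le> k"
  shows "0 < clique_root d l k"
  using clique_poly_ge_one[OF assms, of d] by (simp add: clique_root_def)

lemma ln_clique_root:
  assumes "0 \<le> l" "0 \<le> k"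
  shows "ln (clique_root d l k) = ln (clique_poly d l k) / (real d + 1)"
  using clique_poly_ge_one[OF assms, of d] by (simp add: clique_root_def)

text \<open>With x = 1 + m l and y = 1 + m k, the polynomials of index m - 1 and m are x y P and x y
  Q, and those of index m - 1 with one weight 0 are x and y. Logarithms are therefore linear in s
  and t up to ln P and ln Q.\<close>

lemma ln_clique_root_combination:
  fixes m :: nat
  assumes m: "1 \<le> m" and lk: "0 \<le> l" "0 \<le> k"
    and s: "s = ln (1 + real m * l) / real m" and t: "t = ln (1 + real m * k) / real m"
  shows "(1 - w1 - w2) * ln (clique_root (m - 1) l k) + w1 * ln (clique_root (m - 1) 0 k)
    + w2 * ln (clique_root (m - 1) l 0) - ln (clique_root m l k) = vertex_gap w1 w2 (real m) s t"
proof -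
  define x where "x = 1 + real m * l"
  define y where "y = 1 + real m * k"
  have x: "1 \<le> x" and y: "1 \<le> y" using lk by (auto simp: x_def y_def)
  have m0: "0 < real m" "real (m - 1) = real m - 1" using m by auto
  have ms: "real m * s = ln x" "real m * t = ln y" using m0 by (auto simp: s t x_def y_def)
  have st: "0 \<le> s" "0 \<le> t" using m0 x y by (auto simp: s t x_def[symmetric] y_def[symmetric])
  have ex1: "exp (- (real m * s)) = 1 / x" "exp (- (real m * t)) = 1 / y"
    using x y unfolding ms by (auto simp: exp_minus field_simps)
  have "exp (- (real m * (s + t))) = exp (- (real m * s)) * exp (- (real m * t))"
    by (simp add: exp_add[symmetric] distrib_left)
  then have ex: "exp (- (real m * s)) = 1 / x" "exp (- (real m * t)) = 1 / y"
    "exp (- (real m * (s + t))) = 1 / (x * y)"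
    using ex1 by simp_all
  define P where "P = 1 - (1 - 1 / x) * (1 - 1 / y) / real m"
  define Q where "Q = 1 + (1 - 1 / (x * y)) / real m"
  have P: "0 < P" using exp_product_less_one[of "real m" s t] m st unfolding ex P_def by simp
  have Q: "0 < Q" using one_plus_exp_pos[of "real m" "s + t"] m st unfolding ex Q_def by simp
  have "clique_poly (m - 1) l k = x * y * P"
  proof -
    have "x * y * P = x * y - (x - 1) * (y - 1) / real m"
      unfolding P_def using x y m0 by (simp add: field_simps)
    also have "(x - 1) * (y - 1) / real m = real m * l * k"
      using m0 by (simp add: x_def y_def)
    finally show ?thesis
      unfolding clique_poly_def m0(2) by (simp add: x_def y_def algebra_simps)
  qed
  then have c1: "ln (clique_root (m - 1) l k) = s + t + ln P / real m"
    using lk m0 x y P ms by (simp add: ln_clique_root ln_mult_pos field_simps)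
  have "clique_poly m l k = x * y * Q"
  proof -
    have "x * y * Q = x * y + (x * y - 1) / real m"
      unfolding Q_def using x y m0 by (simp add: field_simps)
    also have "(x * y - 1) / real m = l + k + real m * l * k"
      using m0 by (simp add: x_def y_def field_simps)
    finally show ?thesis
      unfolding clique_poly_def by (simp add: x_def y_def algebra_simps)
  qed
  then have c2: "ln (clique_root m l k) = (real m * (s + t) + ln Q) / (real m + 1)"
    using lk m0 x y Q ms by (simp add: ln_clique_root ln_mult_pos distrib_left)
  have c3: "ln (clique_root (m - 1) 0 k) = t" "ln (clique_root (m - 1) l 0) = s"
    using lk m0 by (simp_all add: ln_clique_root clique_poly_def s t add.commute)
  have "(real m * (s + t) + ln Q) / (real m + 1) = s + t - (s + t - ln Q) / (real m + 1)"
    using m0 by (simp add: field_simps)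
  then show ?thesis
    unfolding c1 c2 c3 vertex_gap_def ex P_def[symmetric] Q_def[symmetric]
    by (simp add: algebra_simps add_divide_distrib diff_divide_distrib)
qed

text \<open>Add up ln z <= z - 1 at z = x_i / (w_i S) with weights w_i, where S is the sum of the
  x_i; the terms w_i z sum to 1 and cancel the sum of the weights.\<close>

lemma weighted_am_gm_log3:
  fixes x0 x1 x2 w0 w1 w2 :: real
  assumes x: "0 < x0" "0 < x1" "0 < x2" and w: "0 < w0" "0 < w1" "0 < w2" "w0 + w1 + w2 = 1"
  shows "w0 * (ln x0 - ln w0) + w1 * (ln x1 - ln w1) + w2 * (ln x2 - ln w2) \<le> ln (x0 + x1 + x2)"
proof -
  define S where "S = x0 + x1 + x2"
  have S: "0 < S" using x by (simp add: S_def)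
  have *: "w * (ln x - ln w) \<le> w * ln S + x / S - w" if "0 < x" "0 < w" for x w
  proof -
    have "w * ln (x / (w * S)) \<le> w * (x / (w * S) - 1)"
      using that S by (intro mult_left_mono ln_le_minus_one) auto
    then show ?thesis using that S by (simp add: ln_div ln_mult_pos algebra_simps)
  qed
  have "w0 * (ln x0 - ln w0) + w1 * (ln x1 - ln w1) + w2 * (ln x2 - ln w2)
      \<le> (w0 + w1 + w2) * ln S + (x0 + x1 + x2) / S - (w0 + w1 + w2)"
    using *[OF x(1) w(1)] *[OF x(2) w(2)] *[OF x(3) w(3)]
    by (simp add: algebra_simps add_divide_distrib)
  also have "\<dots> = ln S" using w(4) S by (simp add: S_def)
  finally show ?thesis by (simp add: S_def)
qed

text \<open>The weights are those for which AM-GM is an equality when all neighbours have degree $d$ and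
  weights $a, b$, as in the complete graph on $d + 1$ vertices.\<close>
lemma neighbourhood_ineq_pos:
  fixes m :: "'a \<Rightarrow> nat" and l k :: "'a \<Rightarrow> real"
  assumes N: "finite N" "card N = d" and d: "1 \<le> d"
    and m: "\<And>u. u \<in> N \<Longrightarrow> 1 \<le> m u \<and> m u \<le> d"
    and lk: "\<And>u. u \<in> N \<Longrightarrow> 0 \<le> l u" "\<And>u. u \<in> N \<Longrightarrow> 0 \<le> k u"
    and ab: "0 < a" "0 < b"
  shows "clique_root d a b * (\<Prod>u\<in>N. clique_root (m u) (l u) (k u))
    \<le> (\<Prod>u\<in>N. clique_root (m u - 1) (l u) (k u)) + a * (\<Prod>u\<in>N. clique_root (m u - 1) 0 (k u))
      + b * (\<Prod>u\<in>N. clique_root (m u - 1) (l u) 0)"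
proof -
  define D where "D = real d"
  define W where "W = clique_poly d a b"
  define x where "x = 1 + D * a"
  define y where "y = 1 + D * b"
  \<comment> \<open>The three weights are the probabilities that a vertex of the complete graph on d
    + 1 vertices lies in neither set, in I, or in J; \<open>sumW\<close> is the vertex recurrence
    there.\<close>
  define w0 where "w0 = clique_poly (d - 1) a b / W"
  define w1 where "w1 = a * y / W"
  define w2 where "w2 = b * x / W"
  have D: "1 \<le> D" "real (d - 1) = D - 1" using d by (auto simp: D_def)
  have xy: "1 < x" "1 < y" using D ab by (auto simp: x_def y_def)
  have W: "0 < W" using clique_poly_ge_one[of a b d] ab by (simp add: W_def)
  have C: "0 < clique_poly (d - 1) a b" using clique_poly_ge_one[of a b "d - 1"] ab by simp
  have w: "0 < w0" "0 < w1" "0 < w2" using W C ab xy by (auto simp: w0_def w1_def w2_def)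
  have sumW: "clique_poly (d - 1) a b + a * y + b * x = W"
    unfolding W_def clique_poly_def D(2) x_def y_def by (simp add: D_def algebra_simps)
  then have w_sum: "w0 + w1 + w2 = 1" using W
    unfolding w0_def w1_def w2_def by (simp add: add_divide_distrib[symmetric])
  then have w0: "w0 = 1 - w1 - w2" by simp
  define s0 where "s0 = ln x / D"
  define t0 where "t0 = ln y / D"
  have st0: "0 < s0" "0 < t0" using xy D by (auto simp: s0_def t0_def)
  have e0: "1 - exp (- (D * s0)) = 1 - 1 / x" "1 - exp (- (D * t0)) = 1 - 1 / y"
    using xy D by (auto simp: s0_def t0_def exp_minus inverse_eq_divide)
  \<comment> \<open>Brings the weights into the form required by \<open>vertex_gap_minimum\<close>,
    whose denominator d + I0 + J0 - I0 * J0 is D * W / (x * y).\<close>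
  have Wxy: "D + ((1 - 1 / x) + (1 - 1 / y) - (1 - 1 / x) * (1 - 1 / y)) = D * W / (x * y)"
  proof -
    have "D + ((1 - 1 / x) + (1 - 1 / y) - (1 - 1 / x) * (1 - 1 / y)) = ((D + 1) * (x * y) - 1) / (x * y)"
      using xy by (simp add: field_simps)
    also have "(D + 1) * (x * y) - 1 = D * W"
      unfolding W_def clique_poly_def D_def[symmetric] x_def y_def by (simp add: algebra_simps)
    finally show ?thesis .
  qed
  have ww: "w1 = (1 - 1 / x) / (D + ((1 - 1 / x) + (1 - 1 / y) - (1 - 1 / x) * (1 - 1 / y)))"
    "w2 = (1 - 1 / y) / (D + ((1 - 1 / x) + (1 - 1 / y) - (1 - 1 / x) * (1 - 1 / y)))"
  proof -
    have nz: "x \<noteq> 0" "y \<noteq> 0" "D \<noteq> 0" "W \<noteq> 0" using xy D(1) W by auto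
    then have "1 - 1 / x = D * a / x" "1 - 1 / y = D * b / y" by (auto simp: x_def y_def field_simps)
    then have "(1 - 1 / x) / (D * W / (x * y)) = w1" "(1 - 1 / y) / (D * W / (x * y)) = w2"
      unfolding w1_def w2_def using nz by (simp_all only: divide_divide_eq_right divide_divide_eq_left times_divide_eq_left) (simp_all add: ac_simps)
    then show "w1 = (1 - 1 / x) / (D + ((1 - 1 / x) + (1 - 1 / y) - (1 - 1 / x) * (1 - 1 / y)))"
      "w2 = (1 - 1 / y) / (D + ((1 - 1 / x) + (1 - 1 / y) - (1 - 1 / x) * (1 - 1 / y)))"
      unfolding Wxy by auto
  qed
  define G where "G = w0 * ln (clique_root (d - 1) a b) + w1 * ln (clique_root (d - 1) 0 b)
    + w2 * ln (clique_root (d - 1) a 0) - ln (clique_root d a b)"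
  have G: "G = vertex_gap w1 w2 D s0 t0"
    unfolding G_def w0 D_def using d ab
    by (intro ln_clique_root_combination) (auto simp: s0_def t0_def x_def y_def D_def)
  have vertex: "G \<le> w0 * ln (clique_root (m u - 1) (l u) (k u)) + w1 * ln (clique_root (m u - 1) 0 (k u))
      + w2 * ln (clique_root (m u - 1) (l u) 0) - ln (clique_root (m u) (l u) (k u))" if u: "u \<in> N" for u
  proof -
    define s where "s = ln (1 + real (m u) * l u) / real (m u)"
    define t where "t = ln (1 + real (m u) * k u) / real (m u)"
    have st: "0 \<le> s" "0 \<le> t" using lk u by (auto simp: s_def t_def)
    have "vertex_gap w1 w2 D s0 t0 \<le> vertex_gap w1 w2 (real (m u)) s t"
    proof (rule vertex_gap_minimum[OF D(1) st0 _ _ st refl refl])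
      show "1 \<le> real (m u)" "real (m u) \<le> D" using m[OF u] by (auto simp: D_def)
    qed (unfold e0, (fact ww)+)
    also have "\<dots> = w0 * ln (clique_root (m u - 1) (l u) (k u)) + w1 * ln (clique_root (m u - 1) 0 (k u))
      + w2 * ln (clique_root (m u - 1) (l u) 0) - ln (clique_root (m u) (l u) (k u))"
      unfolding w0 using m[OF u] lk u by (intro ln_clique_root_combination[symmetric]) (auto simp: s_def t_def)
    finally show ?thesis unfolding G .
  qed
  define P where "P = (\<Prod>u\<in>N. clique_root (m u - 1) (l u) (k u))"
  define Q where "Q = (\<Prod>u\<in>N. clique_root (m u - 1) 0 (k u))"
  define R where "R = (\<Prod>u\<in>N. clique_root (m u - 1) (l u) 0)"
  define M where "M = (\<Prod>u\<in>N. clique_root (m u) (l u) (k u))"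
  have pos: "0 < P" "0 < Q" "0 < R" "0 < M"
    unfolding P_def Q_def R_def M_def using lk by (auto intro!: prod_pos clique_root_pos)
  have lns: "ln P = (\<Sum>u\<in>N. ln (clique_root (m u - 1) (l u) (k u)))"
    "ln Q = (\<Sum>u\<in>N. ln (clique_root (m u - 1) 0 (k u)))"
    "ln R = (\<Sum>u\<in>N. ln (clique_root (m u - 1) (l u) 0))"
    "ln M = (\<Sum>u\<in>N. ln (clique_root (m u) (l u) (k u)))"
    unfolding P_def Q_def R_def M_def using lk N(1)
    by (auto intro!: ln_prod simp: less_imp_neq[OF clique_root_pos, symmetric])
  have "D * G = (\<Sum>u\<in>N. G)" using N by (simp add: D_def)
  also have "\<dots> \<le> w0 * ln P + w1 * ln Q + w2 * ln R - ln M"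
    unfolding lns sum_distrib_left sum.distrib[symmetric] sum_subtractf[symmetric]
    by (intro sum_mono vertex)
  finally have sum: "D * G \<le> w0 * ln P + w1 * ln Q + w2 * ln R - ln M" .
  \<comment> \<open>The equality case of AM-GM: the roots of index d - 1 cancel against the
    numerators of the weights, leaving ln W - D ln W / (D + 1) = ln W / (D + 1).\<close>
  have "ln (clique_root d a b) = D * G + w1 * ln a + w2 * ln b - w0 * ln w0 - w1 * ln w1 - w2 * ln w2"
  proof -
    have lw: "ln w0 = ln (clique_poly (d - 1) a b) - ln W" "ln w1 = ln a + ln y - ln W" "ln w2 = ln b + ln x - ln W"
      unfolding w0_def w1_def w2_def using W C ab xy by (auto simp: ln_div ln_mult_pos)
    have lr: "D * ln (clique_root (d - 1) a b) = ln (clique_poly (d - 1) a b)"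
      "D * ln (clique_root (d - 1) 0 b) = ln y" "D * ln (clique_root (d - 1) a 0) = ln x"
      using D ab by (auto simp: ln_clique_root clique_poly_def x_def y_def add.commute)
    have ld: "ln (clique_root d a b) = ln W / (D + 1)"
      using ab by (simp add: ln_clique_root W_def D_def)
    have "D * G = w0 * (D * ln (clique_root (d - 1) a b)) + w1 * (D * ln (clique_root (d - 1) 0 b))
        + w2 * (D * ln (clique_root (d - 1) a 0)) - D * ln (clique_root d a b)"
      unfolding G_def by (simp add: algebra_simps)
    then have "D * G + w1 * ln a + w2 * ln b - w0 * ln w0 - w1 * ln w1 - w2 * ln w2
        = (w0 + w1 + w2) * ln W - D * ln (clique_root d a b)"
      unfolding lw lr by (simp add: algebra_simps)
    also have "\<dots> = ln (clique_root d a b)" unfolding w_sum ld using D by (simp add: field_simps)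
    finally show ?thesis by simp
  qed
  also have "\<dots> \<le> w0 * (ln P - ln w0) + w1 * (ln (a * Q) - ln w1) + w2 * (ln (b * R) - ln w2) - ln M"
    using sum pos ab by (simp add: ln_mult_pos algebra_simps)
  also have "\<dots> \<le> ln (P + a * Q + b * R) - ln M"
    using weighted_am_gm_log3[of P "a * Q" "b * R" w0 w1 w2] pos ab w w_sum by simp
  finally have "ln (clique_root d a b * M) \<le> ln (P + a * Q + b * R)"
    using pos clique_root_pos[of a b d] ab by (simp add: ln_mult_pos)
  then have "clique_root d a b * M \<le> P + a * Q + b * R"
    using pos clique_root_pos[of a b d] ab by (subst (asm) ln_le_cancel_iff) (auto intro!: add_pos_pos)
  then show ?thesis unfolding P_def Q_def R_def M_def .
qed

text \<open>If a or b is 0, an AM-GM weight and a coordinate of the minimizer vanish, so both are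
  shifted by e > 0 and e tends to 0. For d = 0 both sides are 1 + a + b.\<close>

lemma neighbourhood_ineq:
  fixes m :: "'a \<Rightarrow> nat" and l k :: "'a \<Rightarrow> real"
  assumes N: "finite N" "card N = d"
    and m: "\<And>u. u \<in> N \<Longrightarrow> 1 \<le> m u \<and> m u \<le> d"
    and lk: "\<And>u. u \<in> N \<Longrightarrow> 0 \<le> l u" "\<And>u. u \<in> N \<Longrightarrow> 0 \<le> k u"
    and ab: "0 \<le> a" "0 \<le> b"
  shows "clique_root d a b * (\<Prod>u\<in>N. clique_root (m u) (l u) (k u))
    \<le> (\<Prod>u\<in>N. clique_root (m u - 1) (l u) (k u)) + a * (\<Prod>u\<in>N. clique_root (m u - 1) 0 (k u))
      + b * (\<Prod>u\<in>N. clique_root (m u - 1) (l u) 0)"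
proof (cases "d = 0")
  case True
  then show ?thesis using N ab by (simp add: clique_root_def clique_poly_def)
next
  case False
  then have d: "1 \<le> d" by simp
  define P where "P = (\<Prod>u\<in>N. clique_root (m u - 1) (l u) (k u))"
  define Q where "Q = (\<Prod>u\<in>N. clique_root (m u - 1) 0 (k u))"
  define R where "R = (\<Prod>u\<in>N. clique_root (m u - 1) (l u) 0)"
  define M where "M = (\<Prod>u\<in>N. clique_root (m u) (l u) (k u))"
  have e: "((\<lambda>e. e) \<longlongrightarrow> 0) (at_right (0::real))" by (rule tendsto_ident_at)
  have "clique_poly d (a + 0) (b + 0) \<noteq> 0" using clique_poly_ge_one[OF ab, of d] by simp
  then have lim1: "((\<lambda>e. clique_root d (a + e) (b + e) * M) \<longlongrightarrow> clique_root d (a + 0) (b + 0) * M) (at_right 0)"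
    unfolding clique_root_def clique_poly_def by (intro tendsto_intros e) auto
  have lim2: "((\<lambda>e. P + (a + e) * Q + (b + e) * R) \<longlongrightarrow> P + (a + 0) * Q + (b + 0) * R) (at_right 0)"
    by (intro tendsto_intros e)
  have "\<forall>\<^sub>F e in at_right 0. clique_root d (a + e) (b + e) * M \<le> P + (a + e) * Q + (b + e) * R"
    using eventually_at_right_less[of 0]
  proof eventually_elim
    case (elim e)
    show ?case unfolding P_def Q_def R_def M_def
      using ab elim by (intro neighbourhood_ineq_pos[OF N d m lk]) auto
  qed
  from tendsto_le[OF _ lim2 lim1 this] show ?thesis
    unfolding P_def Q_def R_def M_def by simp
qed

section \<open>Induction on the number of vertices\<close>

text \<open>The induction ranges over all weights, because the recurrence keeps the neighbours of v
  in the graph and sets their weights to 0.\<close>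

lemma prod_clique_root_le_Z2:
  assumes "finite_simple_graph V E"
    and "\<And>v. v \<in> V \<Longrightarrow> 0 \<le> lam v" "\<And>v. v \<in> V \<Longrightarrow> 0 \<le> mu v"
  shows "(\<Prod>v\<in>V. clique_root (graph_degree E v) (lam v) (mu v)) \<le> Z2 V E lam mu"
  using assms
proof (induction "card V" arbitrary: V E lam mu)
  case 0
  then have "V = {}" by (simp add: finite_simple_graph_def)
  then show ?case by (simp add: Z2_empty)
next
  case (Suc n)
  note G = Suc.prems(1) and nonneg = Suc.prems(2,3)
  have V: "finite V" "V \<noteq> {}" using G Suc.hyps(2) by (auto simp: finite_simple_graph_def)
  obtain v where v: "v \<in> V" and vmax: "\<And>u. u \<in> V \<Longrightarrow> graph_degree E u \<le> graph_degree E v"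
  proof -
    have "Max (graph_degree E ` V) \<in> graph_degree E ` V" using V by (intro Max_in) auto
    then obtain v where "v \<in> V" "graph_degree E v = Max (graph_degree E ` V)" by auto
    then show thesis using V by (intro that[of v]) auto
  qed
  define V' where "V' = V - {v}"
  define E' where "E' = {e \<in> E. v \<notin> e}"
  define N where "N = {u. {u, v} \<in> E}"
  define d where "d = graph_degree E"
  have N: "N \<subseteq> V'"
    using G unfolding N_def V'_def finite_simple_graph_def by fastforce
  have V': "finite V'" "n = card V'" using V v Suc.hyps(2) by (auto simp: V'_def)
  have finN: "finite N" using N V' by (auto intro: finite_subset)
  have G': "finite_simple_graph V' E'"
    unfolding V'_def E'_def by (rule finite_simple_graph_delete_vertex[OF G])
  have deg: "graph_degree E' u = (if u \<in> N then d u - 1 else d u)" if "u \<in> V'" for u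
    using graph_degree_delete_vertex[OF G, of u v] that by (auto simp: V'_def E'_def N_def d_def)
  \<comment> \<open>Vertices outside the neighbourhood keep their degree and weights in all three
    terms of the recurrence, so c is a common factor and only neighbours enter
    \<open>neighbourhood_ineq\<close>.\<close>
  define c where "c = (\<Prod>u\<in>V' - N. clique_root (d u) (lam u) (mu u))"
  have c: "0 \<le> c" unfolding c_def using nonneg
    by (intro prod_nonneg less_imp_le[OF clique_root_pos]) (auto simp: V'_def)
  have IH: "c * (\<Prod>u\<in>N. clique_root (d u - 1) (l u) (k u)) \<le> Z2 V' E' l k"
    if lk: "\<And>u. u \<in> V' \<Longrightarrow> 0 \<le> l u \<and> 0 \<le> k u" "\<And>u. u \<in> V' - N \<Longrightarrow> l u = lam u \<and> k u = mu u" for l k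
  proof -
    have "(\<Prod>u\<in>V'. clique_root (graph_degree E' u) (l u) (k u))
        = (\<Prod>u\<in>V' - N. clique_root (graph_degree E' u) (l u) (k u))
          * (\<Prod>u\<in>N. clique_root (graph_degree E' u) (l u) (k u))"
      by (rule prod.subset_diff[OF N V'(1)])
    also have "\<dots> = c * (\<Prod>u\<in>N. clique_root (d u - 1) (l u) (k u))"
      unfolding c_def using N lk deg by (intro arg_cong2[of _ _ _ _ "(*)"] prod.cong refl) auto
    finally show ?thesis using Suc.hyps(1)[OF V'(2) G', of l k] lk(1) by simp
  qed
  let ?P = "\<Prod>u\<in>N. clique_root (d u - 1) (lam u) (mu u)"
  let ?Q = "\<Prod>u\<in>N. clique_root (d u - 1) 0 (mu u)"
  let ?R = "\<Prod>u\<in>N. clique_root (d u - 1) (lam u) 0"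
  have nonneg': "0 \<le> lam u" "0 \<le> mu u" if "u \<in> V'" for u using nonneg that by (auto simp: V'_def)
  have P: "c * ?P \<le> Z2 V' E' lam mu" using nonneg' by (intro IH) auto
  have Q: "c * ?Q \<le> Z2 V' E' (\<lambda>u. if {u, v} \<in> E then 0 else lam u) mu"
    using IH[of "\<lambda>u. if {u, v} \<in> E then 0 else lam u" mu] nonneg' by (simp add: N_def)
  have R: "c * ?R \<le> Z2 V' E' lam (\<lambda>u. if {u, v} \<in> E then 0 else mu u)"
    using IH[of lam "\<lambda>u. if {u, v} \<in> E then 0 else mu u"] nonneg' by (simp add: N_def)
  have step: "clique_root (d v) (lam v) (mu v) * (\<Prod>u\<in>N. clique_root (d u) (lam u) (mu u))
      \<le> ?P + lam v * ?Q + mu v * ?R"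
  proof (rule neighbourhood_ineq[OF finN])
    show "card N = d v" using graph_degree_eq_card_neighbours[OF G] by (simp add: N_def d_def)
    show "1 \<le> d u \<and> d u \<le> d v" if "u \<in> N" for u
    proof
      have "{e \<in> E. u \<in> e} \<noteq> {}" using that by (auto simp: N_def)
      then show "1 \<le> d u" using finite_edges[OF G] by (simp add: d_def graph_degree_def Suc_le_eq card_gt_0_iff)
      show "d u \<le> d v" using vmax that N by (auto simp: d_def V'_def)
    qed
  qed (use nonneg nonneg' N v in auto)
  have "(\<Prod>u\<in>V. clique_root (d u) (lam u) (mu u))
      = clique_root (d v) (lam v) (mu v) * (\<Prod>u\<in>V'. clique_root (d u) (lam u) (mu u))"
    unfolding V'_def by (rule prod.remove[OF V(1) v])
  also have "(\<Prod>u\<in>V'. clique_root (d u) (lam u) (mu u)) = c * (\<Prod>u\<in>N. clique_root (d u) (lam u) (mu u))"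
    unfolding c_def by (rule prod.subset_diff[OF N V'(1)])
  also have "clique_root (d v) (lam v) (mu v) * (c * (\<Prod>u\<in>N. clique_root (d u) (lam u) (mu u)))
      \<le> c * ?P + lam v * (c * ?Q) + mu v * (c * ?R)"
    using mult_left_mono[OF step c] by (simp add: algebra_simps)
  also have "\<dots> \<le> Z2 V E lam mu"
    unfolding Z2_vertex_recurrence[OF G v] V'_def[symmetric] E'_def[symmetric]
    using P Q R nonneg v by (intro add_mono mult_left_mono) auto
  finally show ?case unfolding d_def .
qed

theorem theorem1p4:
  fixes V :: "'a set" and E :: "'a set set" and lam mu :: "'a \<Rightarrow> real"
  assumes "finite_simple_graph V E"
    and "\<And>v. v \<in> V \<Longrightarrow> 0 \<le> lam v"
    and "\<And>v. v \<in> V \<Longrightarrow> 0 \<le> mu v"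
  shows "Z2 V E lam mu \<ge>
      (\<Prod>v\<in>V. Z2_complete (graph_degree E v + 1) (lam v) (mu v) powr (1 / (real (graph_degree E v) + 1)))
    \<and> (\<Prod>v\<in>V. Z2_complete (graph_degree E v + 1) (lam v) (mu v) powr (1 / (real (graph_degree E v) + 1))) =
      (\<Prod>v\<in>V. ((real (graph_degree E v) + 1) * real (graph_degree E v) * lam v * mu v
                + (real (graph_degree E v) + 1) * (lam v + mu v) + 1) powr (1 / (real (graph_degree E v) + 1)))"
  using prod_clique_root_le_Z2[OF assms]
  unfolding Z2_complete_eq clique_root_def clique_poly_def by simp

end
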